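(* Let $p$ be an odd prime, $\Pi$ a $p$-finite profinite group, $A$ a local noetherian pro-$p$ domain with field of fractions $K$, $(t,d):\Pi\to A$ a continuous pseudorepresentation, and $\chi:\Pi\to A^\times$ a continuous character. If $(t,d)$ is $B$-full for some subring $B$ of $K$, then $(\chi t,\chi^2d)$ is also $B$-full.
   Context: A local pro-$p$ ring is a commutative local topological ring that is an inverse limit of finite rings of $p$-power order, with finite residue field. $\Pi$ is $p$-finite if for every open subgroup $\Pi_0\subseteq\Pi$ the set of continuous homomorphisms $\Pi_0\to\mathbb F_p$ is finite. A (2-dimensional) pseudorepresentation of a group $G$ over a commutative ring $B$ is a pair of functions $t:G\to B$, $d:G\to B^\times$ with $t(1)=2$, $d(gh)=d(g)d(h)$, $t(gh)=t(hg)$ and $t(gh)+d(h)t(gh^{-1})=t(g)t(h)$. Generalized matrix algebras: a GMA over $A$ is given by $A$-modules $M,N$ and an $A$-linear $m:M\otimes_AN\to A$ with $m(b\otimes c)b'=m(b'\otimes c)b$ and $m(b\otimes c')c=m(b\otimes c)c'$; the associated $A$-algebra is $R=\begin{pmatrix}A&M\\N&A\end{pmatrix}$ with matrix multiplication using $m$ for products of off-diagonal entries, and $\operatorname{tr}\begin{pmatrix}a&b\\c&e\end{pmatrix}=a+e$, $\det\begin{pmatrix}a&b\\c&e\end{pmatrix}=ae-m(b\otimes c)$. $R$ is faithful if $m$ is nondegenerate. A $(t,d)$-representation is a group homomorphism $\rho:\Pi\to R^\times$, $R$ a faithful GMA over $A$, with $\operatorname{tr}\rho=t$, $\det\rho=d$,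 $A\rho(\Pi)=R$. As $A$ is a domain, $M,N$ embed $A$-linearly in $K$ so that $m$ becomes multiplication, giving an embedding $\iota:R\hookrightarrow M_2(K)$. Fullness: for a subring $B$ of $K$, $(t,d)$ is $B$-full if there are a $(t,d)$-representation $\rho$, an embedding $\iota$, a nonzero ideal $\mathfrak b$ of $B$ and $x\in\mathrm{GL}_2(K)$ with $x^{-1}\iota(\rho(\Pi))x\supseteq\ker(\mathrm{SL}_2(B)\to\mathrm{SL}_2(B/\mathfrak b))$.
   Formalization: The formal theorem additionally assumes that B is not the field with three elements; for B = F_3 the claim as stated fails (A = F_3[[X]], Π = Z_3 ×_{Z/3} SL_2(F_3), χ(z,g) = (1+X)^z). *)

theory Defs
  imports
    "HOL-Analysis.Analysis"
    "HOL-Computational_Algebra.Computational_Algebra"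
    "HOL-Computational_Algebra.Polynomial_Factorial"
    "HOL-Algebra.Algebra"
    "HOL-Algebra.Algebraic_Closure_Type"
begin

text \<open>
  The coefficient ring \<open>A\<close> is a type of class \<^class>\<open>idom\<close> whose topology is the one of the type
  class; its HOL-Algebra record is \<^const>\<open>ring_of_type_algebra\<close>, and its field of fractions \<open>K\<close> is
  the type of fractions over it, with \<^const>\<open>to_fract\<close> as the inclusion of \<open>A\<close> into \<open>K\<close>.
\<close>

section \<open>Profinite groups and pro-p rings\<close>

definition profinite_group :: "('g, 'r) monoid_scheme \<Rightarrow> 'g topology \<Rightarrow> bool" where
  "profinite_group G T \<longleftrightarrow>
     group G \<and> topspace T = carrier G \<and>
     continuous_map (prod_topology T T) T (\<lambda>(x, y). x \<otimes>\<^bsub>G\<^esub> y) \<and>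
     continuous_map T T (\<lambda>x. inv\<^bsub>G\<^esub> x) \<and>
     compact_space T \<and> Hausdorff_space T \<and>
     (\<forall>x\<in>topspace T. connected_component_of_set T x = {x})"

text \<open>
  The homomorphisms are required to be \<^const>\<open>extensional\<close> because HOL functions are total and
  would otherwise be counted with their values outside the subgroup.
\<close>

definition p_finite :: "nat \<Rightarrow> ('g, 'r) monoid_scheme \<Rightarrow> 'g topology \<Rightarrow> bool" where
  "p_finite p G T \<longleftrightarrow>
     (\<forall>H. subgroup H G \<and> openin T H \<longrightarrow>
        finite {f \<in> extensional H.
          f \<in> hom (G\<lparr>carrier := H\<rparr>) (integer_mod_group p) \<and>
          continuous_map (subtopology T H)
            (discrete_topology (carrier (integer_mod_group p))) f})"

definition directed_preorder :: "'i set \<Rightarrow> ('i \<Rightarrow> 'i \<Rightarrow> bool) \<Rightarrow> bool" where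
  "directed_preorder I po \<longleftrightarrow>
     I \<noteq> {} \<and> (\<forall>i\<in>I. po i i) \<and>
     (\<forall>i\<in>I. \<forall>j\<in>I. \<forall>k\<in>I. po i j \<longrightarrow> po j k \<longrightarrow> po i k) \<and>
     (\<forall>i\<in>I. \<forall>j\<in>I. \<exists>k\<in>I. po i k \<and> po j k)"

definition inverse_system_of_rings ::
    "'i set \<Rightarrow> ('i \<Rightarrow> 'i \<Rightarrow> bool) \<Rightarrow> ('i \<Rightarrow> ('b, 'r) ring_scheme) \<Rightarrow> ('i \<Rightarrow> 'i \<Rightarrow> 'b \<Rightarrow> 'b) \<Rightarrow> bool"
  where
  "inverse_system_of_rings I po S f \<longleftrightarrow>
     directed_preorder I po \<and> (\<forall>i\<in>I. ring (S i)) \<and>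
     (\<forall>i\<in>I. \<forall>j\<in>I. po i j \<longrightarrow> f i j \<in> ring_hom (S j) (S i)) \<and>
     (\<forall>i\<in>I. \<forall>x\<in>carrier (S i). f i i x = x) \<and>
     (\<forall>i\<in>I. \<forall>j\<in>I. \<forall>k\<in>I. po i j \<longrightarrow> po j k \<longrightarrow>
        (\<forall>x\<in>carrier (S k). f i j (f j k x) = f i k x))"

definition inverse_limit_set ::
    "'i set \<Rightarrow> ('i \<Rightarrow> 'i \<Rightarrow> bool) \<Rightarrow> ('i \<Rightarrow> ('b, 'r) ring_scheme) \<Rightarrow> ('i \<Rightarrow> 'i \<Rightarrow> 'b \<Rightarrow> 'b)
      \<Rightarrow> ('i \<Rightarrow> 'b) set" where
  "inverse_limit_set I po S f =
     {x \<in> (\<Pi>\<^sub>E i\<in>I. carrier (S i)). \<forall>i\<in>I. \<forall>j\<in>I. po i j \<longrightarrow> f i j (x j) = x i}"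

text \<open>
  In \<open>local_pro_p_ring\<close> the index set is taken in the type of sets of ring elements and the finite
  rings are carried by sets of natural numbers. This is no restriction: a ring that is an inverse
  limit of finite rings is also the inverse limit of its quotients by the kernels of the projections,
  which are indexed by these kernels, and every finite ring has a copy on natural numbers.
\<close>

definition local_pro_p_ring ::
    "nat \<Rightarrow> 'a::{comm_ring_1, topological_ab_group_add, topological_semigroup_mult} itself \<Rightarrow> bool"
  where
  "local_pro_p_ring p _ \<longleftrightarrow>
     (\<exists>!\<mm>. maximalideal \<mm> (ring_of_type_algebra :: 'a ring)) \<and>
     (\<forall>\<mm>. maximalideal \<mm> (ring_of_type_algebra :: 'a ring) \<longrightarrow>
        finite (carrier ((ring_of_type_algebra :: 'a ring) Quot \<mm>))) \<and>
     (\<exists>(I :: 'a set set) po (S :: 'a set \<Rightarrow> nat ring) f (\<pi> :: 'a set \<Rightarrow> 'a \<Rightarrow> nat).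
        inverse_system_of_rings I po S f \<and>
        (\<forall>i\<in>I. \<exists>k. finite (carrier (S i)) \<and> card (carrier (S i)) = p ^ k) \<and>
        (\<forall>i\<in>I. \<pi> i \<in> ring_hom ring_of_type_algebra (S i)) \<and>
        homeomorphic_map euclidean
          (subtopology (product_topology (\<lambda>i. discrete_topology (carrier (S i))) I)
             (inverse_limit_set I po S f))
          (\<lambda>a. \<lambda>i\<in>I. \<pi> i a))"

section \<open>Pseudorepresentations and generalized matrix algebras\<close>

definition pseudorepresentation ::
    "('g, 'r) monoid_scheme \<Rightarrow> ('g \<Rightarrow> 'a::comm_ring_1) \<Rightarrow> ('g \<Rightarrow> 'a) \<Rightarrow> bool" where
  "pseudorepresentation G t d \<longleftrightarrow>
     (\<forall>g\<in>carrier G. d g \<in> Units ring_of_type_algebra) \<and>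
     t \<one>\<^bsub>G\<^esub> = 2 \<and>
     (\<forall>g\<in>carrier G. \<forall>h\<in>carrier G.
        d (g \<otimes>\<^bsub>G\<^esub> h) = d g * d h \<and>
        t (g \<otimes>\<^bsub>G\<^esub> h) = t (h \<otimes>\<^bsub>G\<^esub> g) \<and>
        t (g \<otimes>\<^bsub>G\<^esub> h) + d h * t (g \<otimes>\<^bsub>G\<^esub> inv\<^bsub>G\<^esub> h) = t g * t h)"

text \<open>
  The linear map \<open>m\<close> on the tensor product of \<open>M\<close> and \<open>N\<close> is given as a bilinear map.
\<close>

locale gma =
  M: Module.module ring_of_type_algebra M + N: Module.module ring_of_type_algebra N
  for M :: "('a::comm_ring_1, 'm) module" and N :: "('a, 'n) module" +
  fixes m :: "'m \<Rightarrow> 'n \<Rightarrow> 'a"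
  assumes add_left: "\<lbrakk>b \<in> carrier M; b' \<in> carrier M; c \<in> carrier N\<rbrakk>
      \<Longrightarrow> m (b \<oplus>\<^bsub>M\<^esub> b') c = m b c + m b' c"
    and add_right: "\<lbrakk>b \<in> carrier M; c \<in> carrier N; c' \<in> carrier N\<rbrakk>
      \<Longrightarrow> m b (c \<oplus>\<^bsub>N\<^esub> c') = m b c + m b c'"
    and smult_left: "\<lbrakk>b \<in> carrier M; c \<in> carrier N\<rbrakk> \<Longrightarrow> m (a \<odot>\<^bsub>M\<^esub> b) c = a * m b c"
    and smult_right: "\<lbrakk>b \<in> carrier M; c \<in> carrier N\<rbrakk> \<Longrightarrow> m b (a \<odot>\<^bsub>N\<^esub> c) = a * m b c"
    and exchange_left: "\<lbrakk>b \<in> carrier M; b' \<in> carrier M; c \<in> carrier N\<rbrakk>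
      \<Longrightarrow> m b c \<odot>\<^bsub>M\<^esub> b' = m b' c \<odot>\<^bsub>M\<^esub> b"
    and exchange_right: "\<lbrakk>b \<in> carrier M; c \<in> carrier N; c' \<in> carrier N\<rbrakk>
      \<Longrightarrow> m b c' \<odot>\<^bsub>N\<^esub> c = m b c \<odot>\<^bsub>N\<^esub> c'"

locale faithful_gma = gma +
  assumes nondegenerate_left: "\<lbrakk>b \<in> carrier M; \<And>c. c \<in> carrier N \<Longrightarrow> m b c = 0\<rbrakk> \<Longrightarrow> b = \<zero>\<^bsub>M\<^esub>"
    and nondegenerate_right: "\<lbrakk>c \<in> carrier N; \<And>b. b \<in> carrier M \<Longrightarrow> m b c = 0\<rbrakk> \<Longrightarrow> c = \<zero>\<^bsub>N\<^esub>"

text \<open>The tuple \<open>(a, b, c, e)\<close> stands for the matrix with rows \<open>(a, b)\<close> and \<open>(c, e)\<close>.\<close>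

definition gma_algebra ::
    "('a::comm_ring_1, 'm) module \<Rightarrow> ('a, 'n) module \<Rightarrow> ('m \<Rightarrow> 'n \<Rightarrow> 'a)
      \<Rightarrow> ('a, 'a \<times> 'm \<times> 'n \<times> 'a) module" where
  "gma_algebra M N m =
     \<lparr>carrier = UNIV \<times> carrier M \<times> carrier N \<times> UNIV,
      monoid.mult = (\<lambda>(a, b, c, e) (a', b', c', e').
        (a * a' + m b c',
         a \<odot>\<^bsub>M\<^esub> b' \<oplus>\<^bsub>M\<^esub> e' \<odot>\<^bsub>M\<^esub> b,
         a' \<odot>\<^bsub>N\<^esub> c \<oplus>\<^bsub>N\<^esub> e \<odot>\<^bsub>N\<^esub> c',
         m b' c + e * e')),
      monoid.one = (1, \<zero>\<^bsub>M\<^esub>, \<zero>\<^bsub>N\<^esub>, 1),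
      ring.zero = (0, \<zero>\<^bsub>M\<^esub>, \<zero>\<^bsub>N\<^esub>, 0),
      ring.add = (\<lambda>(a, b, c, e) (a', b', c', e').
        (a + a', b \<oplus>\<^bsub>M\<^esub> b', c \<oplus>\<^bsub>N\<^esub> c', e + e')),
      module.smult = (\<lambda>s (a, b, c, e). (s * a, s \<odot>\<^bsub>M\<^esub> b, s \<odot>\<^bsub>N\<^esub> c, s * e))\<rparr>"

definition gma_tr :: "'a::comm_ring_1 \<times> 'm \<times> 'n \<times> 'a \<Rightarrow> 'a" where
  "gma_tr = (\<lambda>(a, b, c, e). a + e)"

definition gma_det :: "('m \<Rightarrow> 'n \<Rightarrow> 'a) \<Rightarrow> 'a::comm_ring_1 \<times> 'm \<times> 'n \<times> 'a \<Rightarrow> 'a" where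
  "gma_det m = (\<lambda>(a, b, c, e). a * e - m b c)"

definition td_representation ::
    "('g, 'r) monoid_scheme \<Rightarrow> ('g \<Rightarrow> 'a::comm_ring_1) \<Rightarrow> ('g \<Rightarrow> 'a)
      \<Rightarrow> ('a, 'm) module \<Rightarrow> ('a, 'n) module \<Rightarrow> ('m \<Rightarrow> 'n \<Rightarrow> 'a)
      \<Rightarrow> ('g \<Rightarrow> 'a \<times> 'm \<times> 'n \<times> 'a) \<Rightarrow> bool" where
  "td_representation G t d M N m \<rho> \<longleftrightarrow>
     faithful_gma M N m \<and>
     \<rho> \<in> hom G (units_of (gma_algebra M N m)) \<and>
     (\<forall>g\<in>carrier G. gma_tr (\<rho> g) = t g) \<and>
     (\<forall>g\<in>carrier G. gma_det m (\<rho> g) = d g) \<and>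
     (\<forall>r\<in>carrier (gma_algebra M N m). \<exists>S c. finite S \<and> S \<subseteq> carrier G \<and>
        r = (\<Oplus>\<^bsub>gma_algebra M N m\<^esub> g\<in>S. c g \<odot>\<^bsub>gma_algebra M N m\<^esub> \<rho> g))"

definition linear_embedding :: "('a::idom, 'm) module \<Rightarrow> ('m \<Rightarrow> 'a fract) \<Rightarrow> bool" where
  "linear_embedding M i \<longleftrightarrow>
     inj_on i (carrier M) \<and>
     (\<forall>b\<in>carrier M. \<forall>b'\<in>carrier M. i (b \<oplus>\<^bsub>M\<^esub> b') = i b + i b') \<and>
     (\<forall>a. \<forall>b\<in>carrier M. i (a \<odot>\<^bsub>M\<^esub> b) = to_fract a * i b)"

definition gma_embedding_pair ::
    "('a::idom, 'm) module \<Rightarrow> ('a, 'n) module \<Rightarrow> ('m \<Rightarrow> 'n \<Rightarrow> 'a)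
      \<Rightarrow> ('m \<Rightarrow> 'a fract) \<Rightarrow> ('n \<Rightarrow> 'a fract) \<Rightarrow> bool" where
  "gma_embedding_pair M N m i j \<longleftrightarrow>
     linear_embedding M i \<and> linear_embedding N j \<and>
     (\<forall>b\<in>carrier M. \<forall>c\<in>carrier N. to_fract (m b c) = i b * j c)"

definition gma_embedding ::
    "('m \<Rightarrow> 'a fract) \<Rightarrow> ('n \<Rightarrow> 'a fract) \<Rightarrow> 'a::idom \<times> 'm \<times> 'n \<times> 'a \<Rightarrow> 'a fract ^ 2 ^ 2" where
  "gma_embedding i j = (\<lambda>(a, b, c, e).
     vector [vector [to_fract a, i b], vector [j c, to_fract e]])"

section \<open>Fullness\<close>

text \<open>The kernel of reduction modulo \<open>\<bb>\<close> on the special linear group of \<open>B\<close>.\<close>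

definition congruence_subgroup :: "'k::field set \<Rightarrow> 'k set \<Rightarrow> ('k ^ 2 ^ 2) set" where
  "congruence_subgroup B \<bb> =
     {\<gamma>. (\<forall>i j. \<gamma> $ i $ j \<in> B) \<and> det \<gamma> = 1 \<and> (\<forall>i j. \<gamma> $ i $ j - mat 1 $ i $ j \<in> \<bb>)}"

text \<open>
  A faithful GMA over a domain has off-diagonal modules that embed in the field of fractions, so
  looking for \<open>M\<close> and \<open>N\<close> among modules carried by subsets of the type of fractions (with arbitrary
  operations) is no restriction.

  The unit ideal is allowed as \<open>\<bb>\<close>, so a finite subring \<open>B\<close> (a finite field) is possible. For the
  field with three elements this notion is not stable under twisting: take \<open>A\<close> the ring of power
  series in \<open>X\<close> over that field \<open>F\<close>, \<open>G\<close> the fibre product of the 3-adic integers and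
  \<open>SL\<^sub>2(F)\<close> over their common quotient of order 3, \<open>\<rho>\<close> the second projection, and
  \<open>\<chi>(z, \<gamma>) = (1 + X)\<^sup>z\<close>. Then \<open>\<rho>\<close> is \<open>F\<close>-full, but the image of the twist of \<open>\<rho>\<close> by \<open>\<chi>\<close> has
  only eight elements of determinant 1, since \<open>(1 + X)\<^sup>2\<^sup>z = 1\<close> forces \<open>z = 0\<close>.
\<close>

definition full ::
    "('g, 'r) monoid_scheme \<Rightarrow> 'a::idom fract set \<Rightarrow> ('g \<Rightarrow> 'a) \<Rightarrow> ('g \<Rightarrow> 'a) \<Rightarrow> bool" where
  "full G B t d \<longleftrightarrow>
     (\<exists>(M :: ('a, 'a fract) module) (N :: ('a, 'a fract) module) m \<rho> i j \<bb> (x :: 'a fract ^ 2 ^ 2).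
        td_representation G t d M N m \<rho> \<and>
        gma_embedding_pair M N m i j \<and>
        ideal \<bb> (ring_of_type_algebra\<lparr>carrier := B\<rparr>) \<and> \<bb> \<noteq> {0} \<and>
        invertible x \<and>
        congruence_subgroup B \<bb>
          \<subseteq> (\<lambda>g. matrix_inv x ** gma_embedding i j (\<rho> g) ** x) ` carrier G)"

end

theory Submission
  imports Defs
begin

text \<open>
  Twisting a \<open>(t, d)\<close>-representation \<open>\<rho>\<close> by \<open>\<chi>\<close> gives a representation for the twisted
  pseudorepresentation in the same GMA (\<open>td_representation_twist\<close>), so the same embedding and the
  same conjugation can be used. The two images \<open>D\<close> of \<open>\<rho>\<close> and \<open>E\<close> of the twist need not contain
  each other, but \<open>\<chi>\<close> is trivial on commutators, so \<open>E\<close> contains all commutators of elements of \<open>D\<close>.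
  It remains to find a congruence subgroup inside the group that commutators of \<open>D\<close> generate,
  knowing that \<open>D\<close> contains one.

  This is not a statement about \<open>SL\<^sub>2(B)\<close> alone: for \<open>B = \<int>\<close> the commutator subgroup of a small
  congruence subgroup has infinite index. What helps is that \<open>D\<close> is compact. Traces of elements of \<open>\<rho>\<close>
  multiplied by fixed elements of the GMA are continuous, so up to scaling the entries of \<open>\<rho>\<close> are
  continuous functions with values in \<open>A\<close>, and \<open>D\<close> is closed under entrywise limits
  (\<open>td_representation_entries_fract_continuous\<close>, \<open>fract_continuous_image_closed\<close>). If \<open>B\<close> is infinite,
  there is a nonzero \<open>w\<close> in \<open>\<bb>\<close> such that \<open>wB\<close> is contained in the maximal ideal of \<open>A\<close>. Then geometric
  series converge, and \<open>D\<close> contains the upper and lower unipotents with entries \<open>wz / (1 + wv)\<close> for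
  \<open>z\<close> and \<open>v\<close> in \<open>B\<close> (\<open>unipotents_in_image_infinite\<close>). If \<open>B\<close> is finite, it is a field, and the same
  holds with \<open>w = 1\<close>.

  The denominators \<open>1 + wv\<close> make the rest an exercise in elementary matrices. The unipotents above
  generate the diagonal matrices with entries \<open>\<alpha>\<close> and \<open>1 / \<alpha>\<close> for all nonzero \<open>\<alpha>\<close> in \<open>1 + w\<^sup>2B\<close>,
  and the commutators of such a matrix with unipotents are the unipotents whose entries are multiplied
  by \<open>\<alpha>\<^sup>2 - 1\<close>. Choose \<open>\<alpha>\<close> with \<open>\<alpha>\<^sup>2 \<noteq> 1\<close>; this is where a field with three elements has to be
  excluded. Then \<open>E\<close> contains the unipotents for \<open>w' = (\<alpha>\<^sup>2 - 1) w\<close> instead of \<open>w\<close>, and these generate a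
  group that contains all matrices in \<open>SL\<^sub>2(B)\<close> congruent to 1 modulo \<open>w'\<^sup>2\<close>
  (\<open>commutators_contain_congruence_subgroup\<close>).
\<close>

\<comment> \<open>Frees the infix dollar sign, which also denotes the coefficients of power series, for matrix entries.\<close>
unbundle no Formal_Power_Series.fps_syntax

section \<open>Unipotent generation of congruence subgroups\<close>

definition mat2 :: "'k::field \<Rightarrow> 'k \<Rightarrow> 'k \<Rightarrow> 'k \<Rightarrow> 'k ^ 2 ^ 2" where
  "mat2 a b c e = vector [vector [a, b], vector [c, e]]"

definition upper_uni :: "'k::field \<Rightarrow> 'k ^ 2 ^ 2" where
  "upper_uni y = mat2 1 y 0 1"

definition lower_uni :: "'k::field \<Rightarrow> 'k ^ 2 ^ 2" where
  "lower_uni y = mat2 1 0 y 1"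

definition torus :: "'k::field \<Rightarrow> 'k ^ 2 ^ 2" where
  "torus a = mat2 a 0 0 (1 / a)"

lemma mat2_nth [simp]:
  "mat2 a b c e $ 1 $ 1 = a" "mat2 a b c e $ 1 $ 2 = b"
  "mat2 a b c e $ 2 $ 1 = c" "mat2 a b c e $ 2 $ 2 = e"
  by (simp_all add: mat2_def)

lemma mat2_eq_iff:
  "g = h \<longleftrightarrow> g $ 1 $ 1 = h $ 1 $ 1 \<and> g $ 1 $ 2 = h $ 1 $ 2 \<and> g $ 2 $ 1 = h $ 2 $ 1 \<and> g $ 2 $ 2 = h $ 2 $ 2"
  for g h :: "'k ^ 2 ^ 2"
  by (auto simp: vec_eq_iff forall_2)

lemma mat2_mult:
  "mat2 a b c e ** mat2 a' b' c' e' =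
     mat2 (a * a' + b * c') (a * b' + b * e') (c * a' + e * c') (c * b' + e * e')"
  by (simp add: mat2_eq_iff matrix_matrix_mult_def sum_2)

lemma mat2_inject [simp]:
  "mat2 a b c e = mat2 a' b' c' e' \<longleftrightarrow> a = a' \<and> b = b' \<and> c = c' \<and> e = e'"
  by (simp add: mat2_eq_iff)

lemma mat_eq_mat2: "(mat s :: 'k::field ^ 2 ^ 2) = mat2 s 0 0 s"
  by (simp add: mat2_eq_iff mat_def)

lemmas mat_1_eq_mat2 = mat_eq_mat2[of 1]

lemma mat2_cases: obtains a b c e where "g = mat2 a b c e"
  by (rule that[of "g $ 1 $ 1" "g $ 1 $ 2" "g $ 2 $ 1" "g $ 2 $ 2"]) (simp add: mat2_eq_iff)

lemmas elementary_simps = upper_uni_def lower_uni_def torus_def mat2_mult mat_1_eq_mat2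

text \<open>
  Clear the matrix \<open>upper_uni x ** lower_uni y\<close>, whose top left entry is \<open>1 + x * y\<close>, by one row and
  one column operation. The outer factors have denominator \<open>1 + x * y\<close>, and this is what forces
  denominators into the set \<open>level\<close> below.
\<close>

lemma torus_eq_product_of_unipotents:
  fixes x y :: "'k::field"
  assumes "1 + x * y \<noteq> 0"
  shows "torus (1 + x * y) =
    lower_uni (- y / (1 + x * y)) ** upper_uni x ** lower_uni y ** upper_uni (- x / (1 + x * y))"
  using assms by (simp add: elementary_simps) (simp add: field_simps)

lemma bruhat_big_cell:
  fixes a :: "'k::field"
  assumes "a \<noteq> 0" and "a * e - b * c = 1"
  shows "mat2 a b c e = lower_uni (c / a) ** torus a ** upper_uni (b / a)"
  using assms by (simp add: elementary_simps) (simp add: field_simps)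

text \<open>
  Subrings and ideals are handled here in terms of the operations of the type class, so that the
  simplifier and the field methods apply to their elements.
\<close>

definition subring_set :: "'k::comm_ring_1 set \<Rightarrow> bool" where
  "subring_set B \<longleftrightarrow> 1 \<in> B \<and> (\<forall>a\<in>B. \<forall>b\<in>B. a - b \<in> B \<and> a * b \<in> B)"

lemma subring_setD:
  assumes "subring_set B"
  shows "1 \<in> B" "0 \<in> B"
    "a \<in> B \<Longrightarrow> b \<in> B \<Longrightarrow> a - b \<in> B"
    "a \<in> B \<Longrightarrow> b \<in> B \<Longrightarrow> a * b \<in> B"
    "a \<in> B \<Longrightarrow> - a \<in> B"
    "a \<in> B \<Longrightarrow> b \<in> B \<Longrightarrow> a + b \<in> B"
    "a \<in> B \<Longrightarrow> a ^ n \<in> B"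
proof -
  note B = assms[unfolded subring_set_def]
  show 1: "1 \<in> B" and diff: "a \<in> B \<Longrightarrow> b \<in> B \<Longrightarrow> a - b \<in> B"
    and mult: "a \<in> B \<Longrightarrow> b \<in> B \<Longrightarrow> a * b \<in> B" for a b
    using B by auto
  show 0: "0 \<in> B" using diff[OF 1 1] by simp
  show neg: "a \<in> B \<Longrightarrow> - a \<in> B" for a using diff[OF 0] by fastforce
  show "a \<in> B \<Longrightarrow> b \<in> B \<Longrightarrow> a + b \<in> B" using diff[OF _ neg] by fastforce
  show "a \<in> B \<Longrightarrow> a ^ n \<in> B" by (induction n) (auto intro: 1 mult)
qed

text \<open>
  The multiples of \<open>w\<close> in the ring obtained from \<open>B\<close> by inverting all nonzero elements of
  \<open>1 + wB\<close>. When \<open>1 + wB\<close> consists of units of \<open>B\<close> this is the ideal \<open>wB\<close>.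
\<close>

definition level :: "'k::field set \<Rightarrow> 'k \<Rightarrow> 'k set" where
  "level B w = {w * z / (1 + w * v) | z v. z \<in> B \<and> v \<in> B \<and> 1 + w * v \<noteq> 0}"

lemma levelI:
  "z \<in> B \<Longrightarrow> v \<in> B \<Longrightarrow> 1 + w * v \<noteq> 0 \<Longrightarrow> y = w * z / (1 + w * v) \<Longrightarrow> y \<in> level B w"
  unfolding level_def by blast

lemma multiple_in_level:
  assumes "subring_set B" "z \<in> B"
  shows "w * z \<in> level B w"
  using levelI[of z B 0 w] assms subring_setD(2) by auto

definition unipotents :: "'k::field set \<Rightarrow> ('k ^ 2 ^ 2) set" where
  "unipotents S = upper_uni ` S \<union> lower_uni ` S"

text \<open>
  Take \<open>x = w\<close> and \<open>y = w z\<close> in the factorisation of a torus element into four unipotents. All four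
  off-diagonal entries are then in \<open>level B w\<close>.
\<close>

lemma torus_in_unipotent_monoid:
  fixes w :: "'k::field"
  assumes B: "subring_set B" and w: "w \<in> B"
    and mult: "\<And>g h. g \<in> D \<Longrightarrow> h \<in> D \<Longrightarrow> g ** h \<in> D"
    and uni: "unipotents (level B w) \<subseteq> D"
    and z: "z \<in> B" and nz: "1 + w\<^sup>2 * z \<noteq> 0"
  shows "torus (1 + w\<^sup>2 * z) \<in> D"
proof -
  note [intro] = subring_setD(1,2,4,5)[OF B]
  have nz': "1 + w * (w * z) \<noteq> 0"
    using nz by (simp add: power2_eq_square mult.assoc)
  have up: "upper_uni y \<in> D" and lo: "lower_uni y \<in> D" if "y \<in> level B w" for y
    using uni that by (auto simp: unipotents_def)
  have "w \<in> level B w" "w * z \<in> level B w"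
    using multiple_in_level[OF B, of _ w] z subring_setD(1)[OF B] by (force, blast)
  moreover have "- w / (1 + w * (w * z)) \<in> level B w"
    using nz' w z by (intro levelI[of "-1" B "w * z"]) auto
  moreover have "- (w * z) / (1 + w * (w * z)) \<in> level B w"
    using nz' w z by (intro levelI[of "- z" B "w * z"]) auto
  ultimately have "lower_uni (- (w * z) / (1 + w * (w * z))) ** upper_uni w ** lower_uni (w * z)
      ** upper_uni (- w / (1 + w * (w * z))) \<in> D"
    by (intro mult up lo) auto
  then show ?thesis
    using torus_eq_product_of_unipotents[OF nz'] by (simp add: power2_eq_square mult.assoc)
qed

text \<open>
  A matrix of determinant 1 with nonzero top left entry \<open>a\<close> is the product of a lower unipotent, the
  torus element of \<open>a\<close> and an upper unipotent. For a matrix that is trivial modulo \<open>w\<^sup>2\<close> the two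
  unipotents have entries in \<open>level B w\<close>, and the torus element is itself a product of such
  unipotents. So over the localisation hidden in \<open>level\<close>, congruence subgroups are generated by
  elementary matrices, which over \<open>B\<close> itself fails in general.
\<close>

lemma congruence_subgroup_subset_unipotent_monoid:
  fixes w :: "'k::field"
  assumes B: "subring_set B" and w: "w \<in> B" "w \<noteq> 0"
    and mult: "\<And>g h. g \<in> D \<Longrightarrow> h \<in> D \<Longrightarrow> g ** h \<in> D"
    and uni: "unipotents (level B w) \<subseteq> D"
  shows "congruence_subgroup B ((*) (w\<^sup>2) ` B) \<subseteq> D"
proof
  note [intro] = subring_setD[OF B]
  have up: "upper_uni y \<in> D" and lo: "lower_uni y \<in> D" if "y \<in> level B w" for y
    using uni that by (auto simp: unipotents_def)
  have big_cell: "mat2 a b c e \<in> D"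
    if a: "a = 1 + w\<^sup>2 * z" "z \<in> B" "a \<noteq> 0" and b: "b \<in> (*) w ` B" and c: "c \<in> (*) w ` B"
      and det: "a * e - b * c = 1" for a b c e z
  proof -
    have quot: "y / a \<in> level B w" if "y \<in> (*) w ` B" for y
    proof -
      from that obtain v where "y = w * v" "v \<in> B" by auto
      then show ?thesis using a w
        by (intro levelI[of v B "w * z"]) (auto simp: power2_eq_square mult.assoc)
    qed
    have "torus a \<in> D"
      using torus_in_unipotent_monoid[OF B w(1) mult uni a(2)] a by simp
    then have "lower_uni (c / a) ** torus a ** upper_uni (b / a) \<in> D"
      by (intro mult up lo quot b c)
    then show ?thesis
      using bruhat_big_cell[OF a(3) det] by simp
  qed
  have sq: "w\<^sup>2 * v \<in> (*) w ` B" if "v \<in> B" for v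
    using that w by (auto simp: power2_eq_square mult.assoc)
  fix g assume g: "g \<in> congruence_subgroup B ((*) (w\<^sup>2) ` B)"
  obtain a b c e where g_eq: "g = mat2 a b c e" by (rule mat2_cases)
  from g have det: "a * e - b * c = 1"
    by (simp add: congruence_subgroup_def g_eq det_2)
  have "a - 1 \<in> (*) (w\<^sup>2) ` B" and "b \<in> (*) (w\<^sup>2) ` B" and "c \<in> (*) (w\<^sup>2) ` B"
    and "e - 1 \<in> (*) (w\<^sup>2) ` B"
    using g by (auto simp: congruence_subgroup_def g_eq mat_1_eq_mat2 forall_2)
  then obtain z b' c' e' where "a - 1 = w\<^sup>2 * z" and b': "b = w\<^sup>2 * b'" "b' \<in> B"
    and c': "c = w\<^sup>2 * c'" "c' \<in> B" and "e - 1 = w\<^sup>2 * e'" and zB: "z \<in> B" "e' \<in> B"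
    by (elim imageE) blast
  then have z: "a = 1 + w\<^sup>2 * z" "z \<in> B" and e': "e = 1 + w\<^sup>2 * e'" "e' \<in> B"
    by (simp_all add: algebra_simps)
  show "g \<in> D"
  proof (cases "a = 0")
    case False
    then show ?thesis
      unfolding g_eq using z b' c' det sq by (intro big_cell) auto
  next
    case True
    \<comment> \<open>Then \<open>w\<close> is a unit of \<open>B\<close>, with inverse \<open>- w z\<close>, and the level imposes no condition, so
      adding the second row to the first gives a matrix in the big cell.\<close>
    then have unit: "w * (- w * z) = 1"
      using z(1) by (simp add: power2_eq_square mult.assoc) (simp add: add_eq_0_iff)
    have all: "v \<in> (*) w ` B" if "v \<in> B" for v
    proof
      have "w * (- w * z * v) = w * (- w * z) * v" by simp
      then show "v = w * (- w * z * v)" unfolding unit by simp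
      show "- w * z * v \<in> B" using w z that by blast
    qed
    have one: "1 \<in> level B w" "- 1 \<in> level B w"
    proof -
      have "1 \<in> (*) w ` B" "-1 \<in> (*) w ` B" by (auto intro!: all)
      then show "1 \<in> level B w" "- 1 \<in> level B w"
        using multiple_in_level[OF B] by (metis imageE)+
    qed
    have bc: "b \<in> B" "c \<in> B" "e \<in> B" using b' c' e' w by auto
    have "mat2 c (b + e) c e \<in> D"
    proof (rule big_cell)
      have "w\<^sup>2 * (- z * (c - 1)) = w * (- w * z) * (c - 1)"
        by (simp add: power2_eq_square)
      then show "c = 1 + w\<^sup>2 * (- z * (c - 1))"
        unfolding unit by simp
      show "- z * (c - 1) \<in> B" using z bc by blast
      show "c \<noteq> 0" using det True by auto
      show "b + e \<in> (*) w ` B" "c \<in> (*) w ` B" using bc by (auto intro!: all)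
      show "c * e - (b + e) * c = 1" using det True by (simp add: algebra_simps)
    qed
    then have "upper_uni (- 1) ** mat2 c (b + e) c e \<in> D"
      by (intro mult up one)
    then show ?thesis
      by (simp add: elementary_simps g_eq True)
  qed
qed

text \<open>
  Conjugating a unipotent with entry \<open>y\<close> by the torus element of \<open>\<alpha>\<close> multiplies \<open>y\<close> by \<open>\<alpha>\<^sup>2\<close> or
  \<open>\<alpha>\<^sup>-\<^sup>2\<close>, so commutators of unipotents with \<open>torus \<alpha>\<close> or \<open>torus (1 / \<alpha>)\<close> are the unipotents with
  entry \<open>(\<alpha>\<^sup>2 - 1) y\<close>. As soon as some \<open>\<alpha>\<close> in \<open>1 + w\<^sup>2B\<close> satisfies \<open>\<alpha> \<noteq> 0\<close> and \<open>\<alpha>\<^sup>2 \<noteq> 1\<close>, commutators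
  therefore contain all unipotents of the smaller level \<open>(\<alpha>\<^sup>2 - 1) w\<close>, and those generate a
  congruence subgroup.
\<close>

lemma commutators_contain_congruence_subgroup:
  fixes w :: "'k::field"
  assumes B: "subring_set B" and w: "w \<in> B" "w \<noteq> 0"
    and mult1: "\<And>g h. g \<in> D \<Longrightarrow> h \<in> D \<Longrightarrow> g ** h \<in> D"
    and inv1: "\<And>g. g \<in> D \<Longrightarrow> \<exists>h\<in>D. h ** g = mat 1"
    and uni: "unipotents (level B w) \<subseteq> D"
    and mult: "\<And>g h. g \<in> E \<Longrightarrow> h \<in> E \<Longrightarrow> g ** h \<in> E"
    and comm: "\<And>g h g' h'. \<lbrakk>g \<in> D; h \<in> D; g' \<in> D; h' \<in> D; g ** g' = mat 1; h ** h' = mat 1\<rbrakk>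
      \<Longrightarrow> g ** h ** g' ** h' \<in> E"
    and z: "z \<in> B" "1 + w\<^sup>2 * z \<notin> {0, 1, - 1}"
  shows "\<exists>w'\<in>B. w' \<noteq> 0 \<and> congruence_subgroup B ((*) (w'\<^sup>2) ` B) \<subseteq> E"
proof -
  note [intro] = subring_setD[OF B]
  define \<alpha> where "\<alpha> = 1 + w\<^sup>2 * z"
  define \<theta> where "\<theta> = \<alpha>\<^sup>2 - 1"
  have \<alpha>: "\<alpha> \<noteq> 0" and "\<theta> \<noteq> 0"
    using z by (auto simp: \<alpha>_def \<theta>_def power2_eq_1_iff)
  moreover have "\<theta> \<in> B"
    unfolding \<alpha>_def \<theta>_def using z w by blast
  ultimately have \<theta>: "\<theta> \<in> B" "\<theta> \<noteq> 0"
    by auto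
  have up: "upper_uni y \<in> D" "lower_uni y \<in> D" if "y \<in> level B w" for y
    using uni that by (auto simp: unipotents_def)
  have neg: "- y \<in> level B w" if y: "y \<in> level B w" for y
  proof -
    obtain u v where "y = w * u / (1 + w * v)" "u \<in> B" "v \<in> B" "1 + w * v \<noteq> 0"
      using y unfolding level_def by blast
    then show ?thesis by (intro levelI[of "- u" B v]) auto
  qed
  have T: "torus \<alpha> \<in> D"
    using torus_in_unipotent_monoid[OF B w(1) mult1 uni z(1)] z by (auto simp: \<alpha>_def)
  obtain h where h: "h \<in> D" "h ** torus \<alpha> = mat 1" using inv1[OF T] by blast
  have "torus \<alpha> ** torus (1 / \<alpha>) = mat 1"
    using \<alpha> by (simp add: elementary_simps)
  then have "h = torus (1 / \<alpha>)"
    using h(2) by (metis matrix_mul_assoc matrix_mul_lid matrix_mul_rid)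
  then have T': "torus (1 / \<alpha>) \<in> D" using h by simp
  have gen: "upper_uni (\<theta> * y) \<in> E" "lower_uni (\<theta> * y) \<in> E" if y: "y \<in> level B w" for y
  proof -
    have "torus \<alpha> ** upper_uni y ** torus (1 / \<alpha>) ** upper_uni (- y) \<in> E"
      using y \<alpha> by (intro comm T T' up neg) (auto simp: elementary_simps)
    then show "upper_uni (\<theta> * y) \<in> E"
      using \<alpha> by (simp add: elementary_simps \<theta>_def power2_eq_square algebra_simps)
    have "torus (1 / \<alpha>) ** lower_uni y ** torus \<alpha> ** lower_uni (- y) \<in> E"
      using y \<alpha> by (intro comm T T' up neg) (auto simp: elementary_simps)
    then show "lower_uni (\<theta> * y) \<in> E"
      using \<alpha> by (simp add: elementary_simps \<theta>_def power2_eq_square algebra_simps)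
  qed
  have "y \<in> (*) \<theta> ` level B w" if y: "y \<in> level B (\<theta> * w)" for y
  proof -
    obtain u v where uv: "y = \<theta> * w * u / (1 + \<theta> * w * v)" "u \<in> B" "v \<in> B" "1 + \<theta> * w * v \<noteq> 0"
      using y unfolding level_def by blast
    show ?thesis
    proof
      show "y = \<theta> * (w * u / (1 + w * (\<theta> * v)))"
        using uv by (simp add: ac_simps)
      show "w * u / (1 + w * (\<theta> * v)) \<in> level B w"
        using uv \<theta> by (intro levelI[of u B "\<theta> * v"]) (auto simp: ac_simps)
    qed
  qed
  then have "unipotents (level B (\<theta> * w)) \<subseteq> E"
    using gen by (auto simp: unipotents_def)
  then have "congruence_subgroup B ((*) ((\<theta> * w)\<^sup>2) ` B) \<subseteq> E"
    using \<theta> w by (intro congruence_subgroup_subset_unipotent_monoid[OF B _ _ mult]) auto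
  moreover have "\<theta> * w \<in> B" "\<theta> * w \<noteq> 0" using \<theta> w by auto
  ultimately show ?thesis by blast
qed

text \<open>
  For infinite \<open>B\<close> there is room in \<open>1 + w\<^sup>2B\<close>. For \<open>w = 1\<close> this coset is \<open>B\<close>, and a ring whose elements
  are \<open>0\<close>, \<open>1\<close> and \<open>-1\<close> has three elements when \<open>2 \<noteq> 0\<close>.
\<close>

lemma exists_nontrivial_torus_parameter:
  fixes B :: "'k::field set"
  assumes B: "subring_set B" and w: "w \<in> B" "w \<noteq> 0"
    and size: "infinite B \<or> w = 1 \<and> card B \<noteq> 3" and two: "(2 :: 'k) \<noteq> 0"
  shows "\<exists>z\<in>B. 1 + w\<^sup>2 * z \<notin> {0, 1, - 1}"
proof (rule ccontr)
  assume "\<not> ?thesis"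
  then have sub: "(\<lambda>z. 1 + w\<^sup>2 * z) ` B \<subseteq> {0, 1, - 1}" by blast
  moreover have inj: "inj_on (\<lambda>z. 1 + w\<^sup>2 * z) B"
    using w by (auto simp: inj_on_def)
  ultimately have "finite B"
    by (meson finite.emptyI finite.insertI finite_imageD finite_subset)
  then have w1: "w = 1" and card: "card B \<noteq> 3" using size by auto
  have "B \<subseteq> {0, 1, - 1}"
  proof
    fix y assume "y \<in> B"
    then have "y - 1 \<in> B" using subring_setD(1,3)[OF B] by blast
    then have "1 + w\<^sup>2 * (y - 1) \<in> {0, 1, - 1}" using sub by blast
    then show "y \<in> {0, 1, - 1}" by (simp add: w1)
  qed
  moreover have "{0, 1, - 1} \<subseteq> B"
    using subring_setD(1,2,5)[OF B] by blast
  ultimately have "B = {0, 1, - 1}" by blast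
  moreover have "(1 :: 'k) \<noteq> - 1"
    using two by (metis add.right_inverse one_add_one)
  ultimately have "card B = 3" by simp
  then show False using card by simp
qed

section \<open>Noetherian local pro-p rings\<close>

lemma ring_of_type_algebra_simps [simp]:
  "carrier ring_of_type_algebra = UNIV"
  "x \<otimes>\<^bsub>ring_of_type_algebra\<^esub> y = x * y"
  "x \<oplus>\<^bsub>ring_of_type_algebra\<^esub> y = x + y"
  "\<one>\<^bsub>ring_of_type_algebra\<^esub> = 1"
  "\<zero>\<^bsub>ring_of_type_algebra\<^esub> = 0"
  by (simp_all add: ring_of_type_algebra_def)

lemma a_inv_ring_of_type_algebra [simp]:
  "\<ominus>\<^bsub>ring_of_type_algebra\<^esub> x = - (x :: 'a::comm_ring_1)"
proof -
  interpret cring "ring_of_type_algebra :: 'a ring" ..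
  show ?thesis by (rule minus_equality) auto
qed

lemma Units_ring_of_type_algebra:
  "x \<in> Units ring_of_type_algebra \<longleftrightarrow> x dvd (1 :: 'a::comm_ring_1)"
  by (auto simp: Units_def dvd_def) (metis mult.commute)+

text \<open>
  Zorn's lemma among the ideals that contain the nonunit but not 1: unions of chains stay in this
  set because in a noetherian ring the union of a chain of ideals belongs to the chain.
\<close>

lemma noetherian_nonunit_in_maximalideal:
  fixes x :: "'a::comm_ring_1"
  assumes noeth: "noetherian_ring (ring_of_type_algebra :: 'a ring)" and x: "\<not> x dvd 1"
  shows "\<exists>\<mm>. maximalideal \<mm> (ring_of_type_algebra :: 'a ring) \<and> x \<in> \<mm>"
proof -
  let ?R = "ring_of_type_algebra :: 'a ring"
  interpret noetherian_ring ?R by fact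
  interpret cring ?R ..
  have proper: "1 \<in> J \<longleftrightarrow> J = UNIV" if "ideal J ?R" for J
    using ideal.one_imp_carrier[OF that] by auto
  define \<S> where "\<S> = {J. ideal J ?R \<and> x \<in> J \<and> 1 \<notin> J}"
  have "\<exists>M\<in>\<S>. \<forall>J\<in>\<S>. M \<subseteq> J \<longrightarrow> J = M"
  proof (rule subset_Zorn_nonempty)
    have "PIdl\<^bsub>?R\<^esub> x \<in> \<S>"
      using cgenideal_ideal[of x] cgenideal_self[of x] x
      by (auto simp: \<S>_def cgenideal_def dvd_def mult.commute)
    then show "\<S> \<noteq> {}" by blast
    fix \<C> assume C: "\<C> \<noteq> {}" "subset.chain \<S> \<C>"
    then have "subset.chain {J. ideal J ?R} \<C>"
      by (auto simp: subset_chain_def \<S>_def)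
    from ideal_chain_is_trivial[OF C(1) this] C(2) show "\<Union>\<C> \<in> \<S>"
      by (auto simp: subset_chain_def)
  qed
  then obtain M where M: "ideal M ?R" "x \<in> M" "1 \<notin> M"
    and max: "\<And>J. J \<in> \<S> \<Longrightarrow> M \<subseteq> J \<Longrightarrow> J = M"
    by (auto simp: \<S>_def)
  have "maximalideal M ?R"
  proof (rule maximalidealI)
    show "carrier ?R \<noteq> M" using M by auto
    show "J = M \<or> J = carrier ?R" if "ideal J ?R" "M \<subseteq> J" for J
    proof (cases "1 \<in> J")
      case True
      then show ?thesis using proper[OF that(1)] by simp
    next
      case False
      then show ?thesis using max[of J] that M by (auto simp: \<S>_def)
    qed
  qed fact
  then show ?thesis using M by blast
qed

locale local_noetherian_pro_p =
  fixes p :: nat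
    and \<mm> :: "'a::{idom, topological_ab_group_add, topological_semigroup_mult} set"
  assumes pro_p: "local_pro_p_ring p TYPE('a)"
    and noetherian: "noetherian_ring (ring_of_type_algebra :: 'a ring)"
    and maximal: "maximalideal \<mm> (ring_of_type_algebra :: 'a ring)"
begin

abbreviation R :: "'a ring" where
  "R \<equiv> ring_of_type_algebra"

sublocale R: cring R ..

sublocale \<mm>: maximalideal \<mm> R
  by (rule maximal)

lemma not_in_max_imp_unit:
  assumes "x \<notin> \<mm>"
  shows "x dvd 1"
proof (rule ccontr)
  assume "\<not> x dvd 1"
  from noetherian_nonunit_in_maximalideal[OF noetherian this]
  obtain \<nn> where "maximalideal \<nn> R" "x \<in> \<nn>" by blast
  moreover have "\<nn> = \<mm>"
    using pro_p maximal \<open>maximalideal \<nn> R\<close> unfolding local_pro_p_ring_def by blast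
  ultimately show False using assms by simp
qed

lemma one_notin_max: "1 \<notin> \<mm>"
  using \<mm>.one_imp_carrier \<mm>.I_notcarr by auto

lemma mult_in_max: "x \<in> \<mm> \<Longrightarrow> x * y \<in> \<mm>"
  using \<mm>.I_r_closed[of x y] by simp

lemma one_plus_max_unit:
  assumes "u \<in> \<mm>"
  shows "(1 + u) dvd 1"
proof (rule not_in_max_imp_unit)
  show "1 + u \<notin> \<mm>"
  proof
    assume "1 + u \<in> \<mm>"
    then have "(1 + u) + - u \<in> \<mm>"
      using \<mm>.a_closed[of "1 + u" "- u"] \<mm>.a_inv_closed[OF assms] by simp
    then show False using one_notin_max by simp
  qed
qed

lemma infinite_has_congruent_pair:
  assumes "infinite S"
  shows "\<exists>x\<in>S. \<exists>y\<in>S. x \<noteq> y \<and> x - y \<in> \<mm>"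
proof -
  have "finite (carrier (R Quot \<mm>))"
    using pro_p maximal unfolding local_pro_p_ring_def by blast
  moreover have "(\<lambda>x. \<mm> +>\<^bsub>R\<^esub> x) ` S \<subseteq> carrier (R Quot \<mm>)"
    by (auto simp: FactRing_def A_RCOSETS_def')
  ultimately have "\<not> inj_on (\<lambda>x. \<mm> +>\<^bsub>R\<^esub> x) S"
    using assms by (meson finite_imageD finite_subset)
  then obtain x y where xy: "x \<in> S" "y \<in> S" "x \<noteq> y" "\<mm> +>\<^bsub>R\<^esub> x = \<mm> +>\<^bsub>R\<^esub> y"
    by (auto simp: inj_on_def)
  then have "x \<ominus>\<^bsub>R\<^esub> y \<in> \<mm>"
    using R.quotient_eq_iff_same_a_r_cos[OF \<mm>.is_ideal, of x y] by simp
  then show ?thesis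
    using xy by (auto simp: a_minus_def)
qed

text \<open>
  All that is used below of the inverse system: the topology is the initial one for the maps to
  the finite rings, and these maps separate points.
\<close>

lemma finite_quotients:
  "\<exists>(I :: 'a set set) (S :: 'a set \<Rightarrow> nat ring) \<pi> C.
    (\<forall>i\<in>I. ring (S i) \<and> finite (carrier (S i)) \<and> (\<exists>k. card (carrier (S i)) = p ^ k) \<and>
      \<pi> i \<in> ring_hom R (S i)) \<and>
    homeomorphic_map euclidean
      (subtopology (product_topology (\<lambda>i. discrete_topology (carrier (S i))) I) C)
      (\<lambda>a. \<lambda>i\<in>I. \<pi> i a)"
proof -
  obtain I :: "'a set set" and po and S :: "'a set \<Rightarrow> nat ring" and f \<pi>
    where "inverse_system_of_rings I po S f"
      "\<forall>i\<in>I. \<exists>k. finite (carrier (S i)) \<and> card (carrier (S i)) = p ^ k"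
      "\<forall>i\<in>I. \<pi> i \<in> ring_hom R (S i)"
      "homeomorphic_map euclidean
        (subtopology (product_topology (\<lambda>i. discrete_topology (carrier (S i))) I)
          (inverse_limit_set I po S f)) (\<lambda>a. \<lambda>i\<in>I. \<pi> i a)"
    using pro_p unfolding local_pro_p_ring_def by (elim conjE exE)
  then show ?thesis
    by (intro exI[of _ I] exI[of _ S] exI[of _ \<pi>] exI[of _ "inverse_limit_set I po S f"])
       (auto simp: inverse_system_of_rings_def)
qed

lemma Hausdorff: "Hausdorff_space (euclidean :: 'a topology)"
proof -
  obtain I :: "'a set set" and S :: "'a set \<Rightarrow> nat ring"
    and \<pi> :: "'a set \<Rightarrow> 'a \<Rightarrow> nat" and C
    where h: "homeomorphic_map euclidean
      (subtopology (product_topology (\<lambda>i. discrete_topology (carrier (S i))) I) C)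
      (\<lambda>a. \<lambda>i\<in>I. \<pi> i a)"
    using finite_quotients by (elim exE conjE)
  have "Hausdorff_space (subtopology (product_topology (\<lambda>i. discrete_topology (carrier (S i))) I) C)"
    by (intro Hausdorff_space_subtopology)
       (simp add: Hausdorff_space_product_topology)
  then show ?thesis
    using homeomorphic_Hausdorff_space h homeomorphic_map_imp_homeomorphic_space by blast
qed

text \<open>
  In each finite quotient the powers of \<open>u\<close> repeat, say \<open>u\<^sup>m = u\<^sup>m\<^sup>+\<^sup>k\<close> with \<open>k > 0\<close>. Since
  \<open>1 - u\<^sup>k\<close> is a unit, \<open>u\<^sup>m\<close> vanishes there.
\<close>

lemma power_max_tendsto_0:
  assumes u: "u \<in> \<mm>"
  shows "(\<lambda>n. u ^ n) \<longlonglongrightarrow> 0"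
proof -
  obtain I :: "'a set set" and S :: "'a set \<Rightarrow> nat ring"
    and \<pi> :: "'a set \<Rightarrow> 'a \<Rightarrow> nat" and C
    where fin: "\<forall>i\<in>I. ring (S i) \<and> finite (carrier (S i)) \<and> (\<exists>k. card (carrier (S i)) = p ^ k)
        \<and> \<pi> i \<in> ring_hom R (S i)"
      and h: "homeomorphic_map euclidean
        (subtopology (product_topology (\<lambda>i. discrete_topology (carrier (S i))) I) C)
        (\<lambda>a. \<lambda>i\<in>I. \<pi> i a)" (is "homeomorphic_map _ ?Y ?h")
    using finite_quotients by (elim exE conjE)
  have S: "ring (S i) \<and> finite (carrier (S i)) \<and> (\<exists>k. card (carrier (S i)) = p ^ k)"
    and \<pi>: "\<pi> i \<in> ring_hom R (S i)" if "i \<in> I" for i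
    using fin that by auto
  have nilpotent: "eventually (\<lambda>n. \<pi> i (u ^ n) = \<pi> i 0) sequentially" if i: "i \<in> I" for i
  proof -
    interpret S: ring "S i" using S[OF i] by blast
    interpret hom: ring_hom_ring R "S i" "\<pi> i"
      using \<pi>[OF i] by (intro ring_hom_ringI2) (auto intro: R.ring_axioms S.ring_axioms)
    have "range (\<lambda>n. \<pi> i (u ^ n)) \<subseteq> carrier (S i)"
      using hom.hom_closed by auto
    then have "\<not> inj (\<lambda>n. \<pi> i (u ^ n))"
      using S[OF i] by (meson finite_imageD finite_subset infinite_UNIV_nat)
    then obtain m n where mn: "m < n" "\<pi> i (u ^ m) = \<pi> i (u ^ n)"
      unfolding inj_def by (metis linorder_neqE_nat)
    define k where "k = n - m"
    have k: "n = m + k" "k > 0" using mn by (auto simp: k_def)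
    have "- (u ^ k) \<in> \<mm>"
      using mult_in_max[OF u, of "- (u ^ (k - 1))"] k by (simp flip: power_Suc)
    from one_plus_max_unit[OF this] obtain v where v: "1 = (1 - u ^ k) * v"
      by (auto simp: dvd_def)
    have "\<pi> i (u ^ m * (1 - u ^ k)) = \<pi> i (u ^ m + - (u ^ n))"
      by (simp add: k power_add algebra_simps)
    also have "\<dots> = \<pi> i 0"
      using hom.hom_add[of "u ^ m" "- (u ^ n)"] hom.hom_a_inv[of "u ^ n"] mn hom.hom_zero
      by (simp add: S.r_neg)
    finally have 0: "\<pi> i (u ^ m * (1 - u ^ k)) = \<zero>\<^bsub>S i\<^esub>"
      using hom.hom_zero by simp
    have "\<pi> i (u ^ j) = \<pi> i 0" if "j \<ge> m" for j
    proof -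
      have "u ^ j = (u ^ m * (1 - u ^ k)) * (v * u ^ (j - m))"
      proof -
        have "u ^ j = u ^ m * u ^ (j - m) * ((1 - u ^ k) * v)"
          using that by (simp flip: v power_add)
        then show ?thesis by (simp only: ac_simps)
      qed
      then show ?thesis
        using hom.hom_mult[of "u ^ m * (1 - u ^ k)" "v * u ^ (j - m)"] 0 hom.hom_zero
        by simp
    qed
    then show ?thesis by (auto simp: eventually_sequentially)
  qed
  have "limitin ?Y (\<lambda>n. ?h (u ^ n)) (?h 0) sequentially"
    unfolding limitin_subtopology limitin_componentwise
  proof (intro conjI ballI)
    have "?h a \<in> ?h ` topspace euclidean" for a
      by (rule imageI) simp
    then have h_in: "?h a \<in> topspace ?Y" for a
      unfolding homeomorphic_imp_surjective_map[OF h] .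
    then have C: "?h a \<in> C" and P: "?h a \<in> topspace (product_topology (\<lambda>i. discrete_topology (carrier (S i))) I)" for a
      by (auto simp only: topspace_subtopology)
    show "?h 0 \<in> C" by (rule C)
    show "\<forall>\<^sub>F n in sequentially. ?h (u ^ n) \<in> C" by (intro always_eventually allI C)
    show "?h 0 \<in> extensional I" by simp
    show "\<forall>\<^sub>F n in sequentially. ?h (u ^ n) \<in> topspace (product_topology (\<lambda>i. discrete_topology (carrier (S i))) I)"
      by (intro always_eventually allI P)
    fix i assume i: "i \<in> I"
    have "\<pi> i 0 \<in> carrier (S i)"
      using ring_hom_closed[OF \<pi>[OF i]] by simp
    then show "limitin (discrete_topology (carrier (S i))) (\<lambda>n. ?h (u ^ n) i) (?h 0 i) sequentially"
      using nilpotent[OF i] i by (auto simp: limitin_def elim: eventually_mono)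
  qed
  moreover obtain g where "homeomorphic_maps euclidean ?Y ?h g"
    using h homeomorphic_map_maps by blast
  then have "continuous_map ?Y euclidean g" and g: "\<And>a. g (?h a) = a"
    by (auto simp: homeomorphic_maps_def)
  ultimately have "limitin euclidean (g \<circ> (\<lambda>n. ?h (u ^ n))) (g (?h 0)) sequentially"
    by (intro continuous_map_limit)
  then show ?thesis by (simp add: g o_def)
qed

text \<open>
  If \<open>2 = 0\<close>, the additive order of 1 in a finite quotient divides both 2 and a power of \<open>p\<close>, so
  that every finite quotient is zero, and then so is the ring.
\<close>

lemma two_neq_0:
  assumes "odd p"
  shows "(2 :: 'a) \<noteq> 0"
proof
  assume 2: "(2 :: 'a) = 0"
  obtain I :: "'a set set" and S :: "'a set \<Rightarrow> nat ring"
    and \<pi> :: "'a set \<Rightarrow> 'a \<Rightarrow> nat" and C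
    where fin: "\<forall>i\<in>I. ring (S i) \<and> finite (carrier (S i)) \<and> (\<exists>k. card (carrier (S i)) = p ^ k)
        \<and> \<pi> i \<in> ring_hom R (S i)"
      and h: "homeomorphic_map euclidean
        (subtopology (product_topology (\<lambda>i. discrete_topology (carrier (S i))) I) C)
        (\<lambda>a. \<lambda>i\<in>I. \<pi> i a)" (is "homeomorphic_map _ ?Y ?h")
    using finite_quotients by (elim exE conjE)
  have S: "ring (S i) \<and> finite (carrier (S i)) \<and> (\<exists>k. card (carrier (S i)) = p ^ k)"
    and \<pi>: "\<pi> i \<in> ring_hom R (S i)" if "i \<in> I" for i
    using fin that by auto
  have "\<pi> i 1 = \<pi> i 0" if i: "i \<in> I" for i
  proof -
    interpret S: ring "S i" using S[OF i] by blast
    interpret hom: ring_hom_ring R "S i" "\<pi> i"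
      using \<pi>[OF i] by (intro ring_hom_ringI2) (auto intro: R.ring_axioms S.ring_axioms)
    obtain k where k: "card (carrier (S i)) = p ^ k" using S[OF i] by blast
    note A = S.a_group
    have one: "\<pi> i 1 = \<one>\<^bsub>S i\<^esub>" using hom.hom_one by simp
    have "\<pi> i (1 + 1) = \<one>\<^bsub>S i\<^esub> \<oplus>\<^bsub>S i\<^esub> \<one>\<^bsub>S i\<^esub>"
      using hom.hom_add[of 1 1] one by simp
    then have "\<one>\<^bsub>S i\<^esub> \<oplus>\<^bsub>S i\<^esub> \<one>\<^bsub>S i\<^esub> = \<zero>\<^bsub>S i\<^esub>"
      using 2 hom.hom_zero by simp
    then have "\<one>\<^bsub>S i\<^esub> [^]\<^bsub>add_monoid (S i)\<^esub> (2 :: nat) = \<one>\<^bsub>add_monoid (S i)\<^esub>"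
      by (simp add: numeral_2_eq_2)
    then have "group.ord (add_monoid (S i)) (\<one>\<^bsub>S i\<^esub>) dvd 2"
      using group.pow_eq_id[OF A, of "\<one>\<^bsub>S i\<^esub>" 2] by simp
    moreover have "group.ord (add_monoid (S i)) (\<one>\<^bsub>S i\<^esub>) dvd p ^ k"
      using group.ord_dvd_group_order[OF A, of "\<one>\<^bsub>S i\<^esub>"] k by (simp add: order_def)
    moreover have "coprime 2 (p ^ k)" using assms by simp
    ultimately have "group.ord (add_monoid (S i)) (\<one>\<^bsub>S i\<^esub>) = 1"
      by (meson coprime_common_divisor_nat coprime_def nat_dvd_1_iff_1)
    then have "\<one>\<^bsub>S i\<^esub> = \<zero>\<^bsub>S i\<^esub>"
      using group.ord_eq_1[OF A, of "\<one>\<^bsub>S i\<^esub>"] by simp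
    then show ?thesis using one hom.hom_zero by simp
  qed
  then have "?h 1 = ?h 0" by auto
  moreover have "inj ?h"
    using homeomorphic_imp_injective_map[OF h] by simp
  ultimately show False by (auto dest: injD)
qed

end

section \<open>Generalized matrix algebras and twists\<close>

lemma gma_algebra_simps:
  "carrier (gma_algebra M N m) = UNIV \<times> carrier M \<times> carrier N \<times> UNIV"
  "\<one>\<^bsub>gma_algebra M N m\<^esub> = (1, \<zero>\<^bsub>M\<^esub>, \<zero>\<^bsub>N\<^esub>, 1)"
  "\<zero>\<^bsub>gma_algebra M N m\<^esub> = (0, \<zero>\<^bsub>M\<^esub>, \<zero>\<^bsub>N\<^esub>, 0)"
  "(a, b, c, e) \<otimes>\<^bsub>gma_algebra M N m\<^esub> (a', b', c', e') =
     (a * a' + m b c', a \<odot>\<^bsub>M\<^esub> b' \<oplus>\<^bsub>M\<^esub> e' \<odot>\<^bsub>M\<^esub> b, a' \<odot>\<^bsub>N\<^esub> c \<oplus>\<^bsub>N\<^esub> e \<odot>\<^bsub>N\<^esub> c', m b' c + e * e')"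
  "(a, b, c, e) \<oplus>\<^bsub>gma_algebra M N m\<^esub> (a', b', c', e') =
     (a + a', b \<oplus>\<^bsub>M\<^esub> b', c \<oplus>\<^bsub>N\<^esub> c', e + e')"
  "s \<odot>\<^bsub>gma_algebra M N m\<^esub> (a, b, c, e) = (s * a, s \<odot>\<^bsub>M\<^esub> b, s \<odot>\<^bsub>N\<^esub> c, s * e)"
  by (simp_all add: gma_algebra_def)

context gma
begin

abbreviation E where "E \<equiv> gma_algebra M N m"

lemma m_zero: "c \<in> carrier N \<Longrightarrow> m \<zero>\<^bsub>M\<^esub> c = 0" "b \<in> carrier M \<Longrightarrow> m b \<zero>\<^bsub>N\<^esub> = 0"
  using add_left[of "\<zero>\<^bsub>M\<^esub>" "\<zero>\<^bsub>M\<^esub>" c] add_right[of b "\<zero>\<^bsub>N\<^esub>" "\<zero>\<^bsub>N\<^esub>"] by auto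

lemma abelian_monoid_gma: "abelian_monoid E"
  by (rule abelian_monoidI)
     (auto simp: gma_algebra_simps M.a_ac N.a_ac algebra_simps)

lemma smult_in_gma: "y \<in> carrier E \<Longrightarrow> s \<odot>\<^bsub>E\<^esub> y \<in> carrier E"
  by (cases y) (auto simp: gma_algebra_simps)

lemma smult_assoc_gma: "y \<in> carrier E \<Longrightarrow> s \<odot>\<^bsub>E\<^esub> (s' \<odot>\<^bsub>E\<^esub> y) = (s * s') \<odot>\<^bsub>E\<^esub> y"
  using M.smult_assoc1 N.smult_assoc1
  by (cases y) (auto simp: gma_algebra_simps mult.assoc)

lemma smult_one_gma: "y \<in> carrier E \<Longrightarrow> 1 \<odot>\<^bsub>E\<^esub> y = y"
  using M.smult_one N.smult_one
  by (cases y) (auto simp: gma_algebra_simps)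

lemma smult_mult_smult:
  assumes "y \<in> carrier E" "z \<in> carrier E"
  shows "(s \<odot>\<^bsub>E\<^esub> y) \<otimes>\<^bsub>E\<^esub> (s' \<odot>\<^bsub>E\<^esub> z) = (s * s') \<odot>\<^bsub>E\<^esub> (y \<otimes>\<^bsub>E\<^esub> z)"
  using assms M.smult_assoc1[symmetric] N.smult_assoc1[symmetric]
  by (cases y; cases z)
     (auto simp: gma_algebra_simps M.smult_r_distr N.smult_r_distr smult_left smult_right algebra_simps)

lemma gma_tr_smult: "gma_tr (s \<odot>\<^bsub>E\<^esub> y) = s * gma_tr y"
  by (cases y) (simp add: gma_algebra_simps gma_tr_def algebra_simps)

lemma gma_det_smult: "y \<in> carrier E \<Longrightarrow> gma_det m (s \<odot>\<^bsub>E\<^esub> y) = s\<^sup>2 * gma_det m y"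
  by (cases y)
     (auto simp: gma_algebra_simps gma_det_def smult_left smult_right algebra_simps power2_eq_square)

lemma gma_tr_lincomb_mult:
  assumes S: "finite S" "\<And>h. h \<in> S \<Longrightarrow> r h \<in> carrier E" and z: "z \<in> carrier E"
  shows "gma_tr ((\<Oplus>\<^bsub>E\<^esub> h\<in>S. c h \<odot>\<^bsub>E\<^esub> r h) \<otimes>\<^bsub>E\<^esub> z) = (\<Sum>h\<in>S. c h * gma_tr (r h \<otimes>\<^bsub>E\<^esub> z))"
  using S
proof (induction S rule: finite_induct)
  case empty
  interpret E: abelian_monoid E by (rule abelian_monoid_gma)
  show ?case using z by (cases z) (auto simp: gma_algebra_simps gma_tr_def m_zero)
next
  case (insert h S)
  interpret E: abelian_monoid E by (rule abelian_monoid_gma)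
  have add: "gma_tr ((u \<oplus>\<^bsub>E\<^esub> v) \<otimes>\<^bsub>E\<^esub> z) = gma_tr (u \<otimes>\<^bsub>E\<^esub> z) + gma_tr (v \<otimes>\<^bsub>E\<^esub> z)"
    if "u \<in> carrier E" "v \<in> carrier E" for u v
    using that z
    by (cases u; cases v; cases z) (auto simp: gma_algebra_simps gma_tr_def add_left add_right algebra_simps)
  have in_E: "(\<lambda>h. c h \<odot>\<^bsub>E\<^esub> r h) \<in> S \<rightarrow> carrier E" "c h \<odot>\<^bsub>E\<^esub> r h \<in> carrier E"
    using insert.prems by (auto intro: smult_in_gma)
  have "gma_tr ((c h \<odot>\<^bsub>E\<^esub> r h) \<otimes>\<^bsub>E\<^esub> z) = c h * gma_tr (r h \<otimes>\<^bsub>E\<^esub> z)"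
    using smult_mult_smult[of "r h" z "c h" 1] insert.prems z
    by (simp add: smult_one_gma gma_tr_smult)
  then show ?case
    using insert in_E by (simp add: E.finsum_insert add)
qed

end

lemma gma_embedding_eq_mat2:
  "gma_embedding i j (a, b, c, e) = mat2 (to_fract a) (i b) (j c) (to_fract e)"
  by (simp add: gma_embedding_def mat2_def)

lemma gma_embedding_mult:
  assumes "gma M N m" and "gma_embedding_pair M N m i j"
    and "y \<in> carrier (gma_algebra M N m)" "z \<in> carrier (gma_algebra M N m)"
  shows "gma_embedding i j (y \<otimes>\<^bsub>gma_algebra M N m\<^esub> z) = gma_embedding i j y ** gma_embedding i j z"
proof -
  interpret gma M N m by fact
  show ?thesis
    using assms(2-)
    by (cases y; cases z)
       (auto simp: gma_algebra_simps gma_embedding_eq_mat2 mat2_mult gma_embedding_pair_def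
          linear_embedding_def algebra_simps)
qed

lemma gma_embedding_one:
  assumes "gma M N m" and "gma_embedding_pair M N m i j"
  shows "gma_embedding i j \<one>\<^bsub>gma_algebra M N m\<^esub> = mat 1"
proof -
  interpret gma M N m by fact
  have "i \<zero>\<^bsub>M\<^esub> = i \<zero>\<^bsub>M\<^esub> + i \<zero>\<^bsub>M\<^esub>" "j \<zero>\<^bsub>N\<^esub> = j \<zero>\<^bsub>N\<^esub> + j \<zero>\<^bsub>N\<^esub>"
    using assms(2) M.zero_closed N.zero_closed M.l_zero N.l_zero
    unfolding gma_embedding_pair_def linear_embedding_def by metis+
  then have "i \<zero>\<^bsub>M\<^esub> = 0" "j \<zero>\<^bsub>N\<^esub> = 0"
    by (metis add_cancel_right_right)+
  then show ?thesis
    by (simp add: gma_algebra_simps gma_embedding_eq_mat2 mat_1_eq_mat2)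
qed

lemma td_representationD:
  assumes "td_representation G t d M N m \<rho>"
  shows "faithful_gma M N m" "gma M N m"
    and "g \<in> carrier G \<Longrightarrow> \<rho> g \<in> carrier (gma_algebra M N m)"
    and "g \<in> carrier G \<Longrightarrow> h \<in> carrier G \<Longrightarrow>
      \<rho> (g \<otimes>\<^bsub>G\<^esub> h) = \<rho> g \<otimes>\<^bsub>gma_algebra M N m\<^esub> \<rho> h"
    and "g \<in> carrier G \<Longrightarrow> gma_tr (\<rho> g) = t g"
proof -
  show f: "faithful_gma M N m" using assms by (simp add: td_representation_def)
  show "gma M N m" by (rule faithful_gma.axioms(1)[OF f])
  have hom: "\<rho> \<in> hom G (units_of (gma_algebra M N m))"
    using assms by (simp add: td_representation_def)
  show "g \<in> carrier G \<Longrightarrow> \<rho> g \<in> carrier (gma_algebra M N m)"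
    using hom by (auto simp: hom_def units_of_def Units_def)
  show "g \<in> carrier G \<Longrightarrow> h \<in> carrier G \<Longrightarrow>
      \<rho> (g \<otimes>\<^bsub>G\<^esub> h) = \<rho> g \<otimes>\<^bsub>gma_algebra M N m\<^esub> \<rho> h"
    using hom by (auto simp: hom_def units_of_def)
  show "g \<in> carrier G \<Longrightarrow> gma_tr (\<rho> g) = t g"
    using assms by (simp add: td_representation_def)
qed

text \<open>
  Multiplying by units of the coefficient ring changes neither the GMA nor the linear span of the
  image.
\<close>

lemma td_representation_twist:
  fixes chi t d :: "'g \<Rightarrow> 'a::comm_ring_1"
  assumes rep: "td_representation G t d M N m \<rho>"
    and chi: "chi \<in> hom G (units_of (ring_of_type_algebra :: 'a ring))"
  shows "td_representation G (\<lambda>g. chi g * t g) (\<lambda>g. (chi g)\<^sup>2 * d g) M N m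
    (\<lambda>g. chi g \<odot>\<^bsub>gma_algebra M N m\<^esub> \<rho> g)"
proof -
  note R = td_representationD[OF rep]
  interpret faithful_gma M N m by (rule R(1))
  interpret E: abelian_monoid E by (rule abelian_monoid_gma)
  have hom: "\<rho> \<in> hom G (units_of E)"
    using rep by (simp add: td_representation_def)
  have chi_mult: "chi (g \<otimes>\<^bsub>G\<^esub> h) = chi g * chi h" if "g \<in> carrier G" "h \<in> carrier G" for g h
    using chi that by (simp add: hom_def units_of_def)
  have "\<exists>u. chi g * u = 1" if "g \<in> carrier G" for g
  proof -
    have "chi g \<in> Units (ring_of_type_algebra :: 'a ring)"
      using hom_in_carrier[OF chi that] by (simp add: units_of_def)
    then show ?thesis by (auto simp: Units_ring_of_type_algebra dvd_def)
  qed
  then obtain \<psi> where \<psi>: "chi g * \<psi> g = 1" if "g \<in> carrier G" for g by metis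
  have unit: "chi g \<odot>\<^bsub>E\<^esub> \<rho> g \<in> Units E" if g: "g \<in> carrier G" for g
  proof -
    have "\<rho> g \<in> Units E"
      using hom_in_carrier[OF hom g] by (simp add: units_of_def)
    then obtain y where y: "y \<in> carrier E" "y \<otimes>\<^bsub>E\<^esub> \<rho> g = \<one>\<^bsub>E\<^esub>" "\<rho> g \<otimes>\<^bsub>E\<^esub> y = \<one>\<^bsub>E\<^esub>"
      by (auto simp: Units_def)
    have "\<one>\<^bsub>E\<^esub> \<in> carrier E" by (simp add: gma_algebra_simps)
    then have "(\<psi> g \<odot>\<^bsub>E\<^esub> y) \<otimes>\<^bsub>E\<^esub> (chi g \<odot>\<^bsub>E\<^esub> \<rho> g) = \<one>\<^bsub>E\<^esub>"
      "(chi g \<odot>\<^bsub>E\<^esub> \<rho> g) \<otimes>\<^bsub>E\<^esub> (\<psi> g \<odot>\<^bsub>E\<^esub> y) = \<one>\<^bsub>E\<^esub>"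
      using y R(3)[OF g] \<psi>[OF g]
      by (simp_all add: smult_mult_smult smult_one_gma mult.commute[of "\<psi> g"])
    then show ?thesis
      unfolding Units_def using y(1) R(3)[OF g] smult_in_gma by blast
  qed
  have span: "\<exists>S c. finite S \<and> S \<subseteq> carrier G \<and>
      r = (\<Oplus>\<^bsub>E\<^esub> g\<in>S. c g \<odot>\<^bsub>E\<^esub> (chi g \<odot>\<^bsub>E\<^esub> \<rho> g))" if r: "r \<in> carrier E" for r
  proof -
    obtain S c where S: "finite S" "S \<subseteq> carrier G" and eq: "r = (\<Oplus>\<^bsub>E\<^esub> g\<in>S. c g \<odot>\<^bsub>E\<^esub> \<rho> g)"
      using rep r unfolding td_representation_def by blast
    have "(\<Oplus>\<^bsub>E\<^esub> g\<in>S. (c g * \<psi> g) \<odot>\<^bsub>E\<^esub> (chi g \<odot>\<^bsub>E\<^esub> \<rho> g)) = r"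
      unfolding eq
    proof (rule E.finsum_cong')
      show "(c g * \<psi> g) \<odot>\<^bsub>E\<^esub> (chi g \<odot>\<^bsub>E\<^esub> \<rho> g) = c g \<odot>\<^bsub>E\<^esub> \<rho> g" if "g \<in> S" for g
        using that S R(3)[of g] \<psi>[of g]
        by (auto simp: smult_assoc_gma mult.assoc mult.commute[of "\<psi> g"])
    qed (use S R(3) in \<open>auto intro!: smult_in_gma\<close>)
    then show ?thesis using S by (intro exI[of _ S] exI[of _ "\<lambda>g. c g * \<psi> g"]) auto
  qed
  show ?thesis
    unfolding td_representation_def
  proof (intro conjI ballI)
    show "faithful_gma M N m" by (rule R(1))
    show "(\<lambda>g. chi g \<odot>\<^bsub>E\<^esub> \<rho> g) \<in> hom G (units_of E)"
      using unit R(3,4) chi_mult by (auto simp: hom_def units_of_def smult_mult_smult)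
    show "gma_tr (chi g \<odot>\<^bsub>E\<^esub> \<rho> g) = chi g * t g" if "g \<in> carrier G" for g
      using R(5)[OF that] by (simp add: gma_tr_smult)
    show "gma_det m (chi g \<odot>\<^bsub>E\<^esub> \<rho> g) = (chi g)\<^sup>2 * d g" if "g \<in> carrier G" for g
      using rep that R(3)[OF that] by (simp add: gma_det_smult td_representation_def)
  qed (use span in blast)
qed

lemma continuous_map_plus:
  fixes F H :: "'g \<Rightarrow> 'a::topological_monoid_add"
  assumes "continuous_map T euclidean F" "continuous_map T euclidean H"
  shows "continuous_map T euclidean (\<lambda>g. F g + H g)"
  using assms by (auto simp: continuous_map_atin intro: tendsto_add)

lemma continuous_map_times:
  fixes F H :: "'g \<Rightarrow> 'a::topological_semigroup_mult"
  assumes "continuous_map T euclidean F" "continuous_map T euclidean H"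
  shows "continuous_map T euclidean (\<lambda>g. F g * H g)"
  using assms by (auto simp: continuous_map_atin intro: tendsto_mult)

lemma continuous_map_finite_sum:
  fixes F :: "'b \<Rightarrow> 'g \<Rightarrow> 'a::topological_comm_monoid_add"
  assumes "\<And>h. h \<in> S \<Longrightarrow> continuous_map T euclidean (F h)"
  shows "continuous_map T euclidean (\<lambda>g. \<Sum>h\<in>S. F h g)"
  using assms by (auto simp: continuous_map_atin intro: tendsto_sum)

text \<open>
  No topology on the modules of the GMA is needed to speak of the continuity of \<open>\<rho>\<close>: as \<open>r\<close> is a
  linear combination of elements \<open>\<rho> h\<close>, the function \<open>g \<mapsto> tr (r \<rho>(g))\<close> is a linear combination of
  the continuous functions \<open>g \<mapsto> t (h g)\<close>.
\<close>

lemma td_representation_coordinate_continuous: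
  fixes t d :: "'g \<Rightarrow> 'a::{comm_ring_1, topological_ab_group_add, topological_semigroup_mult}"
  assumes rep: "td_representation G t d M N m \<rho>" and G: "profinite_group G T"
    and t: "continuous_map T euclidean t" and r: "r \<in> carrier (gma_algebra M N m)"
  shows "continuous_map T euclidean (\<lambda>g. gma_tr (r \<otimes>\<^bsub>gma_algebra M N m\<^esub> \<rho> g))"
proof -
  note R = td_representationD[OF rep]
  interpret gma M N m by (rule R(2))
  interpret G: group G using G by (simp add: profinite_group_def)
  have T: "topspace T = carrier G" and mult: "continuous_map (prod_topology T T) T (\<lambda>(g, h). g \<otimes>\<^bsub>G\<^esub> h)"
    using G by (auto simp: profinite_group_def)
  obtain S c where S: "finite S" "S \<subseteq> carrier G" and eq: "r = (\<Oplus>\<^bsub>E\<^esub> h\<in>S. c h \<odot>\<^bsub>E\<^esub> \<rho> h)"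
    using rep r unfolding td_representation_def by blast
  have shift: "continuous_map T euclidean (\<lambda>g. c h * t (h \<otimes>\<^bsub>G\<^esub> g))" if "h \<in> S" for h
  proof -
    have "continuous_map T (prod_topology T T) (\<lambda>g. (h, g))"
      using that S T by (auto intro!: continuous_map_pairedI)
    from continuous_map_compose[OF continuous_map_compose[OF this mult] t]
    have "continuous_map T euclidean (\<lambda>g. t (h \<otimes>\<^bsub>G\<^esub> g))" by (simp add: o_def)
    then show ?thesis by (intro continuous_map_times) auto
  qed
  have "continuous_map T euclidean (\<lambda>g. \<Sum>h\<in>S. c h * t (h \<otimes>\<^bsub>G\<^esub> g))"
    by (intro continuous_map_finite_sum shift)
  moreover have "gma_tr (r \<otimes>\<^bsub>E\<^esub> \<rho> g) = (\<Sum>h\<in>S. c h * t (h \<otimes>\<^bsub>G\<^esub> g))" if g: "g \<in> topspace T" for g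
  proof -
    have "gma_tr (r \<otimes>\<^bsub>E\<^esub> \<rho> g) = (\<Sum>h\<in>S. c h * gma_tr (\<rho> h \<otimes>\<^bsub>E\<^esub> \<rho> g))"
      unfolding eq using S R(3) g T by (intro gma_tr_lincomb_mult) auto
    also have "\<dots> = (\<Sum>h\<in>S. c h * t (h \<otimes>\<^bsub>G\<^esub> g))"
      using S g T by (intro sum.cong) (auto simp: R(4)[symmetric] R(5) subset_iff)
    finally show ?thesis .
  qed
  ultimately show ?thesis by (intro continuous_map_eq[where g = "\<lambda>g. gma_tr (r \<otimes>\<^bsub>E\<^esub> \<rho> g)"]) auto
qed

section \<open>Compactness of the image\<close>

text \<open>
  The field of fractions carries no topology here. Continuity of a function into it means that a
  fixed nonzero multiple takes values in the ring and is continuous there.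
\<close>

definition fract_continuous ::
    "'g topology \<Rightarrow> ('g \<Rightarrow> 'a::{idom, topological_ab_group_add, topological_semigroup_mult} fract) \<Rightarrow> bool" where
  "fract_continuous T f \<longleftrightarrow>
     (\<exists>s F. s \<noteq> 0 \<and> continuous_map T euclidean F \<and> (\<forall>g\<in>topspace T. to_fract s * f g = to_fract (F g)))"

lemma fract_continuousI:
  "\<lbrakk>s \<noteq> 0; continuous_map T euclidean F; \<And>g. g \<in> topspace T \<Longrightarrow> to_fract s * f g = to_fract (F g)\<rbrakk>
    \<Longrightarrow> fract_continuous T f"
  unfolding fract_continuous_def by blast

lemma fract_continuous_if_multiple:
  assumes "k \<noteq> 0" and F: "continuous_map T euclidean F"
    and eq: "\<And>g. g \<in> topspace T \<Longrightarrow> k * f g = to_fract (F g)"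
  shows "fract_continuous T f"
proof -
  obtain a b where k: "k = to_fract a / to_fract b" "b \<noteq> 0"
    by (cases k) (auto simp: Fract_conv_to_fract)
  show ?thesis
  proof (rule fract_continuousI)
    show "a \<noteq> 0" using k assms(1) by auto
    show "continuous_map T euclidean (\<lambda>g. b * F g)"
      using F by (intro continuous_map_times) auto
    show "to_fract a * f g = to_fract (b * F g)" if "g \<in> topspace T" for g
      using k by (simp add: eq[OF that, symmetric])
  qed
qed

lemma fract_continuous_add:
  assumes "fract_continuous T f" "fract_continuous T h"
  shows "fract_continuous T (\<lambda>g. f g + h g)"
proof -
  obtain s F where F: "s \<noteq> 0" "continuous_map T euclidean F"
    "\<And>g. g \<in> topspace T \<Longrightarrow> to_fract s * f g = to_fract (F g)"
    using assms(1) unfolding fract_continuous_def by blast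
  obtain r H where H: "r \<noteq> 0" "continuous_map T euclidean H"
    "\<And>g. g \<in> topspace T \<Longrightarrow> to_fract r * h g = to_fract (H g)"
    using assms(2) unfolding fract_continuous_def by blast
  show ?thesis
  proof (rule fract_continuousI)
    show "s * r \<noteq> 0" using F H by simp
    show "continuous_map T euclidean (\<lambda>g. r * F g + s * H g)"
      using F H by (intro continuous_map_plus continuous_map_times) auto
    show "to_fract (s * r) * (f g + h g) = to_fract (r * F g + s * H g)" if "g \<in> topspace T" for g
      by (simp add: F(3)[OF that, symmetric] H(3)[OF that, symmetric] algebra_simps)
  qed
qed

lemma fract_continuous_scale:
  assumes "fract_continuous T f"
  shows "fract_continuous T (\<lambda>g. k * f g)"
proof -
  obtain s F where F: "s \<noteq> 0" "continuous_map T euclidean F"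
    "\<And>g. g \<in> topspace T \<Longrightarrow> to_fract s * f g = to_fract (F g)"
    using assms unfolding fract_continuous_def by blast
  obtain a b where k: "k = to_fract a / to_fract b" "b \<noteq> 0"
    by (cases k) (auto simp: Fract_conv_to_fract)
  show ?thesis
  proof (rule fract_continuousI)
    show "b * s \<noteq> 0" using F k by simp
    show "continuous_map T euclidean (\<lambda>g. a * F g)"
      using F by (intro continuous_map_times) auto
    show "to_fract (b * s) * (k * f g) = to_fract (a * F g)" if "g \<in> topspace T" for g
      using k by (simp add: F(3)[OF that, symmetric] field_simps)
  qed
qed

lemma fract_continuous_conjugate:
  fixes \<phi> :: "'g \<Rightarrow> 'a::{idom, topological_ab_group_add, topological_semigroup_mult} fract ^ 2 ^ 2"
  assumes "\<And>k l. fract_continuous T (\<lambda>g. \<phi> g $ k $ l)"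
  shows "fract_continuous T (\<lambda>g. (y ** \<phi> g ** x) $ k $ l)"
proof -
  have "(\<lambda>g. (y ** \<phi> g ** x) $ k $ l) =
    (\<lambda>g. x $ 1 $ l * (y $ k $ 1 * \<phi> g $ 1 $ 1 + y $ k $ 2 * \<phi> g $ 2 $ 1) +
         x $ 2 $ l * (y $ k $ 1 * \<phi> g $ 1 $ 2 + y $ k $ 2 * \<phi> g $ 2 $ 2))"
    by (simp add: matrix_matrix_mult_def sum_2 fun_eq_iff algebra_simps)
  then show ?thesis
    by (simp only:) (intro fract_continuous_add fract_continuous_scale assms)
qed

text \<open>
  The diagonal entries of \<open>\<rho>(g)\<close> are the traces of \<open>r \<rho>(g)\<close> for the two diagonal idempotents \<open>r\<close>.
  If \<open>r\<close> has the single nonzero entry \<open>b'\<close> in \<open>M\<close>, the trace is \<open>m b' c\<close> with \<open>c\<close> the lower left entry of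
  \<open>\<rho>(g)\<close>, so that this entry is continuous after scaling by the fixed element \<open>i b'\<close>; likewise
  for the upper right entry. If no such \<open>b'\<close> exists, nondegeneracy makes the entry zero.
\<close>

lemma td_representation_entries_fract_continuous:
  fixes t d :: "'g \<Rightarrow> 'a::{idom, topological_ab_group_add, topological_semigroup_mult}"
  assumes rep: "td_representation G t d M N m \<rho>" and G: "profinite_group G T"
    and t: "continuous_map T euclidean t" and emb: "gma_embedding_pair M N m i j"
  shows "fract_continuous T (\<lambda>g. gma_embedding i j (\<rho> g) $ k $ l)"
proof -
  note R = td_representationD[OF rep]
  interpret faithful_gma M N m by (rule R(1))
  have T: "topspace T = carrier G"
    using G by (auto simp: profinite_group_def)
  note cont = td_representation_coordinate_continuous[OF rep G t]
  define a b c e where "a g = fst (\<rho> g)" and "b g = fst (snd (\<rho> g))"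
    and "c g = fst (snd (snd (\<rho> g)))" and "e g = snd (snd (snd (\<rho> g)))" for g
  then have \<rho>: "\<rho> g = (a g, b g, c g, e g)" for g
    by simp
  have abce: "b g \<in> carrier M" "c g \<in> carrier N" if "g \<in> carrier G" for g
    using R(3)[OF that] by (auto simp: gma_algebra_simps \<rho>)
  have zero_mod: "i \<zero>\<^bsub>M\<^esub> = 0" "j \<zero>\<^bsub>N\<^esub> = 0"
    using gma_embedding_one[OF R(2) emb]
    by (auto simp: gma_algebra_simps gma_embedding_eq_mat2 mat_eq_mat2)
  have ij: "to_fract (m b' c') = i b' * j c'" if "b' \<in> carrier M" "c' \<in> carrier N" for b' c'
    using emb that by (auto simp: gma_embedding_pair_def)
  have diag: "fract_continuous T (\<lambda>g. to_fract (a g))" "fract_continuous T (\<lambda>g. to_fract (e g))"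
  proof -
    have 1: "(1, \<zero>\<^bsub>M\<^esub>, \<zero>\<^bsub>N\<^esub>, 0) \<in> carrier E" "(0, \<zero>\<^bsub>M\<^esub>, \<zero>\<^bsub>N\<^esub>, 1) \<in> carrier E"
      by (auto simp: gma_algebra_simps)
    have "gma_tr ((1, \<zero>\<^bsub>M\<^esub>, \<zero>\<^bsub>N\<^esub>, 0) \<otimes>\<^bsub>E\<^esub> \<rho> g) = a g" "gma_tr ((0, \<zero>\<^bsub>M\<^esub>, \<zero>\<^bsub>N\<^esub>, 1) \<otimes>\<^bsub>E\<^esub> \<rho> g) = e g"
      if "g \<in> topspace T" for g
      using abce that T by (simp_all add: \<rho> gma_algebra_simps gma_tr_def m_zero)
    then show "fract_continuous T (\<lambda>g. to_fract (a g))" "fract_continuous T (\<lambda>g. to_fract (e g))"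
      using fract_continuous_if_multiple[of 1, OF _ cont[OF 1(1)]]
        fract_continuous_if_multiple[of 1, OF _ cont[OF 1(2)]] by simp_all
  qed
  have b_cont: "fract_continuous T (\<lambda>g. i (b g))"
  proof (cases "\<exists>c'\<in>carrier N. j c' \<noteq> 0")
    case True
    then obtain c' where c': "c' \<in> carrier N" "j c' \<noteq> 0" by blast
    have in_E: "(0, \<zero>\<^bsub>M\<^esub>, c', 0) \<in> carrier E" using c' by (simp add: gma_algebra_simps)
    show ?thesis
    proof (rule fract_continuous_if_multiple[OF c'(2) cont[OF in_E]])
      fix g assume g: "g \<in> topspace T"
      have "gma_tr ((0, \<zero>\<^bsub>M\<^esub>, c', 0) \<otimes>\<^bsub>E\<^esub> \<rho> g) = m (b g) c'"
        using abce c' g T by (simp add: \<rho> gma_algebra_simps gma_tr_def m_zero)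
      then show "j c' * i (b g) = to_fract (gma_tr ((0, \<zero>\<^bsub>M\<^esub>, c', 0) \<otimes>\<^bsub>E\<^esub> \<rho> g))"
        using ij[OF abce(1) c'(1)] g T by (simp add: mult.commute)
    qed
  next
    case False
    then have "i (b g) = 0" if "g \<in> topspace T" for g
      using nondegenerate_left[of "b g"] abce[of g] that T ij zero_mod
      by (metis mult_zero_right to_fract_eq_0_iff)
    then show ?thesis by (auto intro!: fract_continuousI[of 1 T "\<lambda>_. 0"])
  qed
  have c_cont: "fract_continuous T (\<lambda>g. j (c g))"
  proof (cases "\<exists>b'\<in>carrier M. i b' \<noteq> 0")
    case True
    then obtain b' where b': "b' \<in> carrier M" "i b' \<noteq> 0" by blast
    have in_E: "(0, b', \<zero>\<^bsub>N\<^esub>, 0) \<in> carrier E" using b' by (simp add: gma_algebra_simps)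
    show ?thesis
    proof (rule fract_continuous_if_multiple[OF b'(2) cont[OF in_E]])
      fix g assume g: "g \<in> topspace T"
      have "gma_tr ((0, b', \<zero>\<^bsub>N\<^esub>, 0) \<otimes>\<^bsub>E\<^esub> \<rho> g) = m b' (c g)"
        using abce b' g T by (simp add: \<rho> gma_algebra_simps gma_tr_def m_zero)
      then show "i b' * j (c g) = to_fract (gma_tr ((0, b', \<zero>\<^bsub>N\<^esub>, 0) \<otimes>\<^bsub>E\<^esub> \<rho> g))"
        using ij[OF b'(1) abce(2)] g T by simp
    qed
  next
    case False
    then have "j (c g) = 0" if "g \<in> topspace T" for g
      using nondegenerate_right[of "c g"] abce[of g] that T ij zero_mod
      by (metis mult_zero_left to_fract_eq_0_iff)
    then show ?thesis by (auto intro!: fract_continuousI[of 1 T "\<lambda>_. 0"])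
  qed
  have "k = 1 \<or> k = 2" "l = 1 \<or> l = 2" using exhaust_2 by auto
  then show ?thesis
    using diag b_cont c_cont by (auto simp: \<rho> gma_embedding_eq_mat2)
qed

text \<open>
  The scaled entries map the compact space \<open>T\<close> to a compact, hence closed, subset of the fourth power
  of the Hausdorff ring.
\<close>

lemma fract_continuous_image_closed:
  fixes \<phi> :: "'g \<Rightarrow> 'a::{idom, topological_ab_group_add, topological_semigroup_mult} fract ^ 2 ^ 2"
  assumes T: "compact_space T" and H: "Hausdorff_space (euclidean :: 'a topology)"
    and \<phi>: "\<And>k l. fract_continuous T (\<lambda>g. \<phi> g $ k $ l)"
    and seq: "\<And>n. mat2 (to_fract (a n)) (to_fract (b n)) (to_fract (c n)) (to_fract (e n)) \<in> \<phi> ` topspace T"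
    and lim: "a \<longlonglongrightarrow> a'" "b \<longlonglongrightarrow> b'" "c \<longlonglongrightarrow> c'" "e \<longlonglongrightarrow> e'"
  shows "mat2 (to_fract a') (to_fract b') (to_fract c') (to_fract e') \<in> \<phi> ` topspace T"
proof -
  obtain s F where s: "s k l \<noteq> 0" and F: "continuous_map T euclidean (F k l)"
    and sF: "g \<in> topspace T \<Longrightarrow> to_fract (s k l) * \<phi> g $ k $ l = to_fract (F k l g)" for k l g
    using \<phi> unfolding fract_continuous_def by metis
  define \<Phi> where "\<Phi> g = (F 1 1 g, F 1 2 g, F 2 1 g, F 2 2 g)" for g
  let ?X = "prod_topology (euclidean :: 'a topology) (prod_topology (euclidean :: 'a topology)
    (prod_topology (euclidean :: 'a topology) (euclidean :: 'a topology)))"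
  have "continuous_map T ?X \<Phi>"
    unfolding \<Phi>_def by (intro continuous_map_pairedI F)
  then have "compactin ?X (\<Phi> ` topspace T)"
    using T unfolding compact_space_def by (rule image_compactin[rotated])
  moreover have "Hausdorff_space ?X"
    using H by (simp only: Hausdorff_space_prod_topology simp_thms)
  ultimately have closed: "closedin ?X (\<Phi> ` topspace T)"
    by (rule compactin_imp_closedin[rotated])
  \<comment> \<open>Membership of a matrix in the image is membership of its scaled entries in a closed set.\<close>
  let ?u = "\<lambda>a b c e. (s 1 1 * a, s 1 2 * b, s 2 1 * c, s 2 2 * e)"
  have mem: "?u a b c e \<in> \<Phi> ` topspace T \<longleftrightarrow>
      mat2 (to_fract a) (to_fract b) (to_fract c) (to_fract e) \<in> \<phi> ` topspace T" for a b c e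
  proof -
    have "?u a b c e = \<Phi> g \<longleftrightarrow> mat2 (to_fract a) (to_fract b) (to_fract c) (to_fract e) = \<phi> g"
      if "g \<in> topspace T" for g
    proof -
      have *: "s k l * y = F k l g \<longleftrightarrow> to_fract y = \<phi> g $ k $ l" for k l y
      proof -
        have "s k l * y = F k l g \<longleftrightarrow> to_fract (s k l * y) = to_fract (F k l g)"
          by (simp only: to_fract_eq_iff)
        also have "\<dots> \<longleftrightarrow> to_fract (s k l) * to_fract y = to_fract (s k l) * \<phi> g $ k $ l"
          by (simp only: sF[OF that] to_fract_mult)
        also have "\<dots> \<longleftrightarrow> to_fract y = \<phi> g $ k $ l"
          using s[of k l] by simp
        finally show ?thesis .
      qed
      show ?thesis by (simp only: \<Phi>_def prod.inject * mat2_eq_iff mat2_nth)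
    qed
    then show ?thesis by (simp only: image_iff) blast
  qed
  have "limitin ?X (\<lambda>n. ?u (a n) (b n) (c n) (e n)) (?u a' b' c' e') sequentially"
    unfolding limitin_pairwise o_def fst_conv snd_conv limitin_canonical_iff
    by (intro conjI tendsto_mult tendsto_const lim)
  moreover have "?u (a n) (b n) (c n) (e n) \<in> \<Phi> ` topspace T" for n
    using seq[of n] by (simp only: mem)
  ultimately have "?u a' b' c' e' \<in> \<Phi> ` topspace T"
    by (intro limitin_closedin[OF _ closed]) auto
  then show ?thesis by (simp only: mem)
qed

section \<open>Unipotent elements of the image\<close>

definition ideal_set :: "'k::comm_ring_1 set \<Rightarrow> 'k set \<Rightarrow> bool" where
  "ideal_set B \<bb> \<longleftrightarrow> 
     \<bb> \<subseteq> B \<and> 0 \<in> \<bb> \<and> (\<forall>x\<in>\<bb>. \<forall>y\<in>\<bb>. x + y \<in> \<bb>) \<and> (\<forall>x\<in>\<bb>. \<forall>y\<in>B. x * y \<in> \<bb>)"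

lemma subring_set_if_subring:
  fixes B :: "'k::comm_ring_1 set"
  assumes "subring B ring_of_type_algebra"
  shows "subring_set B"
proof -
  have "a + - b \<in> B" if "a \<in> B" "b \<in> B" for a b
    using subringE(5,7)[OF assms] that by (metis a_inv_ring_of_type_algebra ring_of_type_algebra_simps(3))
  then show ?thesis
    using subringE(3,6)[OF assms] by (simp add: subring_set_def)
qed

lemma ideal_set_if_ideal:
  fixes B :: "'k::comm_ring_1 set"
  assumes "ideal \<bb> (ring_of_type_algebra\<lparr>carrier := B\<rparr>)"
  shows "ideal_set B \<bb>"
proof -
  interpret ideal \<bb> "ring_of_type_algebra\<lparr>carrier := B\<rparr>" by fact
  show ?thesis
    using a_subset additive_subgroup.zero_closed[OF is_additive_subgroup]
      additive_subgroup.a_closed[OF is_additive_subgroup] I_r_closed by (auto simp: ideal_set_def)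
qed

lemma principal_ideal_of_subring:
  fixes B :: "'k::comm_ring_1 set"
  assumes B: "subring B ring_of_type_algebra" and w: "w \<in> B"
  shows "ideal ((*) w ` B) (ring_of_type_algebra\<lparr>carrier := B\<rparr>)"
proof -
  interpret R: cring "ring_of_type_algebra :: 'k ring" ..
  have "subcring B ring_of_type_algebra"
    using B by (rule R.subcringI')
  then interpret B: cring "ring_of_type_algebra\<lparr>carrier := B\<rparr>"
    using R.subcring_iff subringE(1)[OF B] by blast
  have "PIdl\<^bsub>ring_of_type_algebra\<lparr>carrier := B\<rparr>\<^esub> w = (*) w ` B"
    by (auto simp: cgenideal_def mult.commute)
  then show ?thesis
    using B.cgenideal_ideal[of w] w by simp
qed

lemma unipotents_subset_congruence_subgroup:
  assumes B: "subring_set B" and \<bb>: "ideal_set B \<bb>"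
  shows "unipotents \<bb> \<subseteq> congruence_subgroup B \<bb>"
proof -
  have "1 \<in> B" "0 \<in> B" "0 \<in> \<bb>" "y \<in> \<bb> \<Longrightarrow> y \<in> B" for y
    using subring_setD(1,2)[OF B] \<bb> by (auto simp: ideal_set_def)
  then show ?thesis
    by (auto simp: unipotents_def congruence_subgroup_def upper_uni_def lower_uni_def
        mat_eq_mat2 forall_2 det_2)
qed

lemma finite_subring_inverse:
  fixes B :: "'k::field set"
  assumes "finite B" "subring_set B" "y \<in> B"
  shows "inverse y \<in> B"
proof (cases "y = 0")
  case False
  have "(*) y ` B = B"
    using assms False subring_setD(4)[OF assms(2)]
    by (intro endo_inj_surj) (auto simp: inj_on_def)
  then obtain z where "z \<in> B" "y * z = 1"
    using subring_setD(1)[OF assms(2)] by (metis imageE)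
  then show ?thesis by (metis inverse_unique)
qed (use assms subring_setD(2)[OF assms(2)] in auto)

text \<open>
  A finite domain is a field, so the nonzero ideal is all of \<open>B\<close> and \<open>level B 1\<close> is contained in \<open>B\<close>.
\<close>

lemma unipotents_in_image_finite:
  fixes B :: "'k::field set"
  assumes B: "finite B" "subring_set B" and \<bb>: "ideal_set B \<bb>" "\<bb> \<noteq> {0}"
    and D: "congruence_subgroup B \<bb> \<subseteq> D"
  shows "unipotents (level B 1) \<subseteq> D"
proof -
  note [intro] = subring_setD[OF B(2)]
  obtain y where y: "y \<in> \<bb>" "y \<noteq> 0" using \<bb> by (auto simp: ideal_set_def)
  have "B \<subseteq> \<bb>"
  proof
    fix z assume z: "z \<in> B"
    have "inverse y \<in> B"
      using finite_subring_inverse[OF B] y \<bb> by (auto simp: ideal_set_def)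
    then have "inverse y * z \<in> B"
      using subring_setD(4)[OF B(2)] z by blast
    then have "y * (inverse y * z) \<in> \<bb>"
      using \<bb>(1) y by (simp add: ideal_set_def)
    moreover have "y * (inverse y * z) = z"
      using y by (simp flip: mult.assoc)
    ultimately show "z \<in> \<bb>" by (simp only:)
  qed
  moreover have "level B 1 \<subseteq> B"
  proof
    fix y assume "y \<in> level B 1"
    then obtain z v where "y = z * inverse (1 + v)" "z \<in> B" "v \<in> B"
      unfolding level_def divide_inverse mult_1 by blast
    moreover have "inverse (1 + v) \<in> B"
      using \<open>v \<in> B\<close> by (intro finite_subring_inverse[OF B] subring_setD[OF B(2)])
    ultimately show "y \<in> B"
      by (simp only: subring_setD(4)[OF B(2)])
  qed
  ultimately have "unipotents (level B 1) \<subseteq> unipotents \<bb>"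
    by (auto simp: unipotents_def)
  then show ?thesis
    using unipotents_subset_congruence_subgroup[OF B(2) \<bb>(1)] D by blast
qed

context local_noetherian_pro_p
begin

text \<open>
  Traces of products of an upper and a lower unipotent in \<open>D\<close> show that \<open>\<bb>\<^sup>2\<close> lies in the coefficient
  ring \<open>A\<close>. For \<open>c \<in> \<bb>\<close> nonzero, \<open>c\<^sup>2B\<close> is then an infinite subset of \<open>A\<close>, and finiteness of the residue
  field gives a nonzero element \<open>c\<^sup>2v\<close> of it in the maximal ideal. Multiplied once more by \<open>c\<^sup>2\<close>, it is an
  element \<open>w\<close> of \<open>\<bb>\<close> with \<open>wB \<subseteq> \<mm>\<close>. Now \<open>1 / (1 + wv)\<close> is the sum of a geometric series, whose partial
  sums are in \<open>B\<close>; as \<open>D\<close> is closed under entrywise limits, the unipotents with entries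
  \<open>wz / (1 + wv)\<close> belong to \<open>D\<close>.
\<close>

lemma unipotents_in_image_infinite:
  fixes B \<bb> :: "'a fract set"
  assumes B: "infinite B" "subring_set B" and \<bb>: "ideal_set B \<bb>" "\<bb> \<noteq> {0}"
    and D: "congruence_subgroup B \<bb> \<subseteq> D"
    and mult: "\<And>g h. g \<in> D \<Longrightarrow> h \<in> D \<Longrightarrow> g ** h \<in> D"
    and trace: "\<And>g. g \<in> D \<Longrightarrow> trace g \<in> range to_fract"
    and closed: "\<And>a b c e a' b' c' e'.
      \<lbrakk>\<And>n. mat2 (to_fract (a n)) (to_fract (b n)) (to_fract (c n)) (to_fract (e n)) \<in> D;
        a \<longlonglongrightarrow> a'; b \<longlonglongrightarrow> b'; c \<longlonglongrightarrow> c'; e \<longlonglongrightarrow> e'\<rbrakk>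
      \<Longrightarrow> mat2 (to_fract a') (to_fract b') (to_fract c') (to_fract e') \<in> D"
  shows "\<exists>w\<in>B. w \<noteq> 0 \<and> unipotents (level B w) \<subseteq> D"
proof -
  note [intro] = subring_setD[OF B(2)]
  have uni: "upper_uni y \<in> D" "lower_uni y \<in> D" if "y \<in> \<bb>" for y
    using unipotents_subset_congruence_subgroup[OF B(2) \<bb>(1)] D that
    by (auto simp: unipotents_def)
  have \<bb>_mult: "y * z \<in> \<bb>" if "y \<in> \<bb>" "z \<in> B" for y z
    using \<bb>(1) that by (simp add: ideal_set_def)
  have \<bb>_B: "y \<in> B" if "y \<in> \<bb>" for y using \<bb>(1) that by (auto simp: ideal_set_def)
  have integral: "y * z \<in> range to_fract" if yz: "y \<in> \<bb>" "z \<in> \<bb>" for y z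
  proof -
    have "trace (upper_uni y ** lower_uni z) \<in> range to_fract"
      using yz by (intro trace mult uni)
    then obtain a where "2 + y * z = to_fract a"
      by (auto simp: elementary_simps trace_def sum_2 algebra_simps)
    then have "y * z = to_fract (a - 2)"
      by (simp add: algebra_simps) (metis one_add_one to_fract_1 to_fract_add)
    then show ?thesis by blast
  qed
  obtain c where c: "c \<in> \<bb>" "c \<noteq> 0" using \<bb> by (auto simp: ideal_set_def)
  have integral_c: "c\<^sup>2 * v \<in> range to_fract" if "v \<in> B" for v
    using integral[OF c(1) \<bb>_mult[OF c(1) that]] by (simp add: power2_eq_square mult.assoc)
  define S where "S = to_fract -` ((*) (c\<^sup>2) ` B)"
  have "to_fract ` S = (*) (c\<^sup>2) ` B"
    unfolding S_def using integral_c by (subst image_vimage_eq) auto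
  moreover have "infinite ((*) (c\<^sup>2) ` B)"
    using B(1) c by (simp add: finite_image_iff inj_on_def)
  ultimately have "infinite S" by (metis finite_imageI)
  from infinite_has_congruent_pair[OF this] obtain a1 a2
    where a: "a1 \<in> S" "a2 \<in> S" "a1 \<noteq> a2" "a1 - a2 \<in> \<mm>" by blast
  obtain v1 v2 where v: "v1 \<in> B" "v2 \<in> B" "to_fract a1 = c\<^sup>2 * v1" "to_fract a2 = c\<^sup>2 * v2"
    using a(1,2) unfolding S_def by auto
  define w where "w = to_fract (a1 - a2) * c\<^sup>2"
  have w_eq: "w = c * (c * (v1 - v2) * c\<^sup>2)"
    by (simp add: w_def v power2_eq_square algebra_simps)
  have w_\<bb>: "w \<in> \<bb>"
    unfolding w_eq using c v \<bb>_B by (intro \<bb>_mult) auto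
  have w_nz: "w \<noteq> 0" using a(3) c by (simp add: w_def del: to_fract_diff)
  have w_max: "\<exists>u\<in>\<mm>. w * y = to_fract u" if y: "y \<in> B" for y
  proof -
    obtain r where "c\<^sup>2 * y = to_fract r" using integral_c[OF y] by blast
    then have "w * y = to_fract ((a1 - a2) * r)"
      by (simp add: w_def mult.assoc)
    then show ?thesis using mult_in_max[OF a(4)] by blast
  qed
  have "upper_uni y \<in> D \<and> lower_uni y \<in> D" if y: "y \<in> level B w" for y
  proof -
    obtain z v where zv: "y = w * z / (1 + w * v)" "z \<in> B" "v \<in> B" "1 + w * v \<noteq> 0"
      using y unfolding level_def by blast
    obtain \<zeta> where \<zeta>: "w * z = to_fract \<zeta>" using w_max[OF zv(2)] by blast
    obtain u where u: "u \<in> \<mm>" "w * v = to_fract u" using w_max[OF zv(3)] by blast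
    obtain r where r: "1 = (1 + u) * r" using one_plus_max_unit[OF u(1)] by (auto simp: dvd_def)
    have "y * (1 + to_fract u) = to_fract \<zeta>"
      using zv(1,4) by (simp add: \<zeta> u(2))
    also have "\<dots> = to_fract (\<zeta> * ((1 + u) * r))" by (simp flip: r)
    also have "\<dots> = to_fract (\<zeta> * r) * (1 + to_fract u)" by (simp add: algebra_simps)
    finally have y_eq: "y = to_fract (\<zeta> * r)"
      using zv(4) u(2) by simp
    define \<eta> where "\<eta> n = \<zeta> * (\<Sum>l<n. (- u) ^ l)" for n
    have geom: "(\<Sum>l<n. (- u) ^ l) = r * (1 - (- u) ^ n)" for n
    proof -
      have "(\<Sum>l<n. (- u) ^ l) = ((1 + u) * r) * (\<Sum>l<n. (- u) ^ l)" by (simp flip: r)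
      also have "\<dots> = r * ((1 - - u) * (\<Sum>l<n. (- u) ^ l))" by (simp add: ac_simps)
      also have "\<dots> = r * (1 - (- u) ^ n)" by (simp only: one_diff_power_eq)
      finally show ?thesis .
    qed
    have "- u \<in> \<mm>" using mult_in_max[OF u(1), of "- 1"] by simp
    from power_max_tendsto_0[OF this]
    have "(\<lambda>n. \<zeta> * (r * (1 - (- u) ^ n))) \<longlonglongrightarrow> \<zeta> * (r * (1 - 0))"
      by (intro tendsto_mult tendsto_diff tendsto_const)
    then have lim: "\<eta> \<longlonglongrightarrow> \<zeta> * r"
      by (simp add: \<eta>_def[abs_def] geom)
    have "to_fract (\<eta> n) \<in> \<bb>" for n
    proof -
      have pow: "to_fract (x ^ l) = to_fract x ^ l" for x :: 'a and l
        by (induction l) simp_all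
      have "to_fract (\<eta> n) = w * (z * (\<Sum>l<n. (- (w * v)) ^ l))"
        by (simp add: \<eta>_def pow \<zeta> u(2) flip: mult.assoc)
      moreover have "(\<Sum>l<n. (- (w * v)) ^ l) \<in> B"
      proof (induction n)
        case (Suc n)
        have "(- (w * v)) ^ n \<in> B" using w_\<bb> \<bb>_B zv(3) by auto
        with Suc show ?case by auto
      qed auto
      ultimately show ?thesis using w_\<bb> zv(2) by (auto intro!: \<bb>_mult)
    qed
    then have "upper_uni (to_fract (\<eta> n)) \<in> D" "lower_uni (to_fract (\<eta> n)) \<in> D" for n
      using uni by auto
    then show ?thesis
      using closed[of "\<lambda>_. 1" \<eta> "\<lambda>_. 0" "\<lambda>_. 1" 1 "\<zeta> * r" 0 1]
        closed[of "\<lambda>_. 1" "\<lambda>_. 0" \<eta> "\<lambda>_. 1" 1 0 "\<zeta> * r" 1] lim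
      by (simp add: y_eq upper_uni_def lower_uni_def)
  qed
  then show ?thesis
    using w_\<bb> w_nz \<bb>_B by (auto simp: unipotents_def)
qed

end

section \<open>Stability of fullness under twists\<close>

lemma matrix_inv_cancel:
  assumes "invertible y"
  shows "y ** matrix_inv y = mat 1" "matrix_inv y ** y = mat 1"
proof -
  have "\<exists>z. y ** z = mat 1 \<and> z ** y = mat 1"
    using assms by (simp add: invertible_def)
  from someI_ex[OF this] show "y ** matrix_inv y = mat 1" "matrix_inv y ** y = mat 1"
    by (simp_all add: matrix_inv_def)
qed

definition conj_rep where
  "conj_rep y i j \<rho> g = matrix_inv y ** gma_embedding i j (\<rho> g) ** y"

lemma conj_rep_mult:
  assumes rep: "td_representation G t d M N m \<rho>" and emb: "gma_embedding_pair M N m i j"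
    and y: "invertible y" and gh: "g \<in> carrier G" "h \<in> carrier G"
  shows "conj_rep y i j \<rho> (g \<otimes>\<^bsub>G\<^esub> h) = conj_rep y i j \<rho> g ** conj_rep y i j \<rho> h"
proof -
  note R = td_representationD[OF rep]
  have "conj_rep y i j \<rho> g ** conj_rep y i j \<rho> h = matrix_inv y ** gma_embedding i j (\<rho> g) **
      (y ** matrix_inv y) ** gma_embedding i j (\<rho> h) ** y"
    by (simp add: conj_rep_def matrix_mul_assoc)
  also have "\<dots> = conj_rep y i j \<rho> (g \<otimes>\<^bsub>G\<^esub> h)"
    using gma_embedding_mult[OF R(2) emb R(3)[OF gh(1)] R(3)[OF gh(2)]]
    by (simp add: conj_rep_def matrix_inv_cancel[OF y] R(4)[OF gh] matrix_mul_assoc)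
  finally show ?thesis by simp
qed

lemma conj_rep_one:
  assumes rep: "td_representation G t d M N m \<rho>" and emb: "gma_embedding_pair M N m i j"
    and y: "invertible y" and G: "group G"
  shows "conj_rep y i j \<rho> \<one>\<^bsub>G\<^esub> = mat 1"
proof -
  note R = td_representationD[OF rep]
  interpret G: group G by fact
  let ?E = "gma_algebra M N m" and ?\<iota> = "gma_embedding i j"
  have "\<rho> \<in> hom G (units_of ?E)" using rep by (simp add: td_representation_def)
  then have "\<rho> \<one>\<^bsub>G\<^esub> \<in> Units ?E"
    using hom_in_carrier[of \<rho> G "units_of ?E"] by (simp add: units_of_def)
  then obtain z where z: "z \<in> carrier ?E" "z \<otimes>\<^bsub>?E\<^esub> \<rho> \<one>\<^bsub>G\<^esub> = \<one>\<^bsub>?E\<^esub>"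
    by (auto simp: Units_def)
  have inv: "?\<iota> z ** ?\<iota> (\<rho> \<one>\<^bsub>G\<^esub>) = mat 1"
    using gma_embedding_mult[OF R(2) emb z(1) R(3)[OF G.one_closed]] z(2) gma_embedding_one[OF R(2) emb] by simp
  have idem: "?\<iota> (\<rho> \<one>\<^bsub>G\<^esub>) ** ?\<iota> (\<rho> \<one>\<^bsub>G\<^esub>) = ?\<iota> (\<rho> \<one>\<^bsub>G\<^esub>)"
    using gma_embedding_mult[OF R(2) emb R(3)[OF G.one_closed] R(3)[OF G.one_closed]] R(4)[of "\<one>\<^bsub>G\<^esub>" "\<one>\<^bsub>G\<^esub>"] by simp
  have "?\<iota> (\<rho> \<one>\<^bsub>G\<^esub>) = ?\<iota> z ** ?\<iota> (\<rho> \<one>\<^bsub>G\<^esub>) ** ?\<iota> (\<rho> \<one>\<^bsub>G\<^esub>)"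
    by (simp add: inv)
  also have "\<dots> = mat 1"
    by (metis idem inv matrix_mul_assoc)
  finally show ?thesis
    by (simp add: conj_rep_def matrix_inv_cancel[OF y])
qed

lemma trace_conj_rep:
  assumes rep: "td_representation G t d M N m \<rho>" and y: "invertible y" and g: "g \<in> carrier G"
  shows "trace (conj_rep y i j \<rho> g) = to_fract (t g)"
proof -
  have "trace (conj_rep y i j \<rho> g) = trace (y ** (matrix_inv y ** gma_embedding i j (\<rho> g)))"
    unfolding conj_rep_def by (rule trace_mul_sym)
  also have "\<dots> = trace (gma_embedding i j (\<rho> g))"
    by (simp add: matrix_mul_assoc matrix_inv_cancel[OF y])
  also have "\<dots> = to_fract (gma_tr (\<rho> g))"
    by (cases "\<rho> g") (simp add: gma_embedding_eq_mat2 trace_def sum_2 gma_tr_def)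
  finally show ?thesis using td_representationD(5)[OF rep g] by simp
qed

theorem corollary3p12:
  fixes p :: nat
    and G :: "('g, 'r) monoid_scheme" and T :: "'g topology"
    and t d chi :: "'g \<Rightarrow> 'a::{idom, topological_ab_group_add, topological_semigroup_mult}"
    and B :: "'a fract set"
  assumes "Factorial_Ring.prime p" and "odd p"
    and "profinite_group G T" and "p_finite p G T"
    and "local_pro_p_ring p TYPE('a)"
    and "noetherian_ring (ring_of_type_algebra :: 'a ring)"
    and "pseudorepresentation G t d"
    and "continuous_map T euclidean t" and "continuous_map T euclidean d"
    and "chi \<in> hom G (units_of ring_of_type_algebra)" and "continuous_map T euclidean chi"
    and "subring B ring_of_type_algebra"
    and B_not_F3: "card B \<noteq> 3"
    and "full G B t d"
  shows "full G B (\<lambda>g. chi g * t g) (\<lambda>g. (chi g)\<^sup>2 * d g)"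
proof -
  obtain \<mm> where \<mm>: "maximalideal \<mm> (ring_of_type_algebra :: 'a ring)"
    using \<open>local_pro_p_ring p TYPE('a)\<close> unfolding local_pro_p_ring_def by blast
  interpret A: local_noetherian_pro_p p \<mm>
    by (rule local_noetherian_pro_p.intro[OF assms(5,6) \<mm>])
  interpret G: group G using assms(3) by (simp add: profinite_group_def)
  have T: "topspace T = carrier G" "compact_space T"
    using assms(3) by (auto simp: profinite_group_def)
  have two: "(2 :: 'a fract) \<noteq> 0"
    using A.two_neq_0[OF \<open>odd p\<close>]
    by (metis one_add_one to_fract_1 to_fract_add to_fract_eq_0_iff)
  have B: "subring_set B" by (rule subring_set_if_subring) fact
  obtain M N :: "('a, 'a fract) module" and m \<rho> i j \<bb> and y :: "'a fract ^ 2 ^ 2"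
    where rep: "td_representation G t d M N m \<rho>" and emb: "gma_embedding_pair M N m i j"
      and ideal: "ideal \<bb> (ring_of_type_algebra\<lparr>carrier := B\<rparr>)" and \<bb>_nz: "\<bb> \<noteq> {0}"
      and y: "invertible y"
      and sub: "congruence_subgroup B \<bb>
        \<subseteq> (\<lambda>g. matrix_inv y ** gma_embedding i j (\<rho> g) ** y) ` carrier G"
    using \<open>full G B t d\<close> unfolding full_def by (elim exE conjE)
  define \<phi> where "\<phi> = conj_rep y i j \<rho>"
  define \<rho>' where "\<rho>' = (\<lambda>g. chi g \<odot>\<^bsub>gma_algebra M N m\<^esub> \<rho> g)"
  define \<psi> where "\<psi> = conj_rep y i j \<rho>'"
  have rep': "td_representation G (\<lambda>g. chi g * t g) (\<lambda>g. (chi g)\<^sup>2 * d g) M N m \<rho>'"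
    unfolding \<rho>'_def by (rule td_representation_twist[OF rep]) fact
  let ?D = "\<phi> ` carrier G" and ?E = "\<psi> ` carrier G"
  have D: "congruence_subgroup B \<bb> \<subseteq> ?D"
    using sub by (simp add: \<phi>_def conj_rep_def[abs_def])
  have \<phi>_mult: "\<phi> (g \<otimes>\<^bsub>G\<^esub> h) = \<phi> g ** \<phi> h" if "g \<in> carrier G" "h \<in> carrier G" for g h
    unfolding \<phi>_def by (rule conj_rep_mult[OF rep emb y that])
  have \<psi>_mult: "\<psi> (g \<otimes>\<^bsub>G\<^esub> h) = \<psi> g ** \<psi> h" if "g \<in> carrier G" "h \<in> carrier G" for g h
    unfolding \<psi>_def by (rule conj_rep_mult[OF rep' emb y that])
  have \<phi>_one: "\<phi> \<one>\<^bsub>G\<^esub> = mat 1"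
    unfolding \<phi>_def by (rule conj_rep_one[OF rep emb y G.is_group])
  have D_mult: "g ** h \<in> ?D" if "g \<in> ?D" "h \<in> ?D" for g h
    using that by (auto simp: \<phi>_mult[symmetric])
  have E_mult: "g ** h \<in> ?E" if "g \<in> ?E" "h \<in> ?E" for g h
    using that by (auto simp: \<psi>_mult[symmetric])
  have \<phi>_inv: "\<phi> (inv\<^bsub>G\<^esub> g) ** \<phi> g = mat 1" if "g \<in> carrier G" for g
    using that by (simp add: \<phi>_mult[symmetric] \<phi>_one)
  have D_inv: "\<exists>h\<in>?D. h ** g = mat 1" if "g \<in> ?D" for g
    using that \<phi>_inv by fastforce
  \<comment> \<open>A character is trivial on commutators, so there the twist agrees with \<open>\<rho>\<close>.\<close>
  have comm: "g ** h ** g' ** h' \<in> ?E"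
    if gh: "g \<in> ?D" "h \<in> ?D" "g ** g' = mat 1" "h ** h' = mat 1" for g h g' h'
  proof -
    obtain u v where uv: "u \<in> carrier G" "v \<in> carrier G" "g = \<phi> u" "h = \<phi> v"
      using gh(1,2) by blast
    have inv_eq: "\<phi> (inv\<^bsub>G\<^esub> u) = r" if "u \<in> carrier G" "\<phi> u ** r = mat 1" for u r
      using \<phi>_inv[OF that(1)] that(2) by (metis matrix_mul_assoc matrix_mul_lid matrix_mul_rid)
    define k where "k = u \<otimes>\<^bsub>G\<^esub> v \<otimes>\<^bsub>G\<^esub> inv\<^bsub>G\<^esub> u \<otimes>\<^bsub>G\<^esub> inv\<^bsub>G\<^esub> v"
    have k: "k \<in> carrier G" using uv by (simp add: k_def)
    have "\<phi> k = g ** h ** g' ** h'"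
      using uv gh(3,4) by (simp add: k_def \<phi>_mult inv_eq)
    moreover have "chi k = 1"
    proof -
      have chi_mult: "chi (a \<otimes>\<^bsub>G\<^esub> b) = chi a * chi b" if "a \<in> carrier G" "b \<in> carrier G" for a b
        using assms(10) that by (simp add: hom_def units_of_def)
      have unit: "chi a dvd 1" if "a \<in> carrier G" for a
        using hom_in_carrier[OF assms(10) that] by (simp add: units_of_def Units_ring_of_type_algebra)
      have "chi \<one>\<^bsub>G\<^esub> * chi \<one>\<^bsub>G\<^esub> = chi \<one>\<^bsub>G\<^esub>"
        using chi_mult[of "\<one>\<^bsub>G\<^esub>" "\<one>\<^bsub>G\<^esub>"] by simp
      moreover have "chi \<one>\<^bsub>G\<^esub> \<noteq> 0" using unit[of "\<one>\<^bsub>G\<^esub>"] by auto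
      ultimately have one: "chi \<one>\<^bsub>G\<^esub> = 1" by simp
      have inv: "chi a * chi (inv\<^bsub>G\<^esub> a) = 1" if "a \<in> carrier G" for a
        using that one by (simp flip: chi_mult)
      have "chi k = (chi u * chi (inv\<^bsub>G\<^esub> u)) * (chi v * chi (inv\<^bsub>G\<^esub> v))"
        using uv by (simp add: k_def chi_mult ac_simps)
      then show ?thesis using inv uv by simp
    qed
    then have "\<psi> k = \<phi> k"
      using gma.smult_one_gma[OF td_representationD(2,3)[OF rep]] k
      by (simp add: \<psi>_def \<phi>_def conj_rep_def \<rho>'_def)
    ultimately show ?thesis using k by (metis imageI)
  qed
  have \<phi>_cont: "fract_continuous T (\<lambda>g. \<phi> g $ k $ l)" for k l
    unfolding \<phi>_def conj_rep_def
    by (intro fract_continuous_conjugate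
        td_representation_entries_fract_continuous[OF rep assms(3,8) emb])
  have "\<exists>w\<in>B. w \<noteq> 0 \<and> (infinite B \<or> w = 1) \<and> unipotents (level B w) \<subseteq> ?D"
  proof (cases "finite B")
    case True
    then show ?thesis
      using unipotents_in_image_finite[OF True B ideal_set_if_ideal[OF ideal] \<bb>_nz D]
        subring_setD(1)[OF B] by auto
  next
    case False
    have "\<exists>w\<in>B. w \<noteq> 0 \<and> unipotents (level B w) \<subseteq> ?D"
    proof (rule A.unipotents_in_image_infinite[OF False B ideal_set_if_ideal[OF ideal] \<bb>_nz D D_mult])
      show "trace g \<in> range to_fract" if "g \<in> ?D" for g
        using that trace_conj_rep[OF rep y] by (auto simp: \<phi>_def)
      show "mat2 (to_fract a') (to_fract b') (to_fract c') (to_fract e') \<in> ?D"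
        if "\<And>n. mat2 (to_fract (a n)) (to_fract (b n)) (to_fract (c n)) (to_fract (e n)) \<in> ?D"
          "a \<longlonglongrightarrow> a'" "b \<longlonglongrightarrow> b'" "c \<longlonglongrightarrow> c'" "e \<longlonglongrightarrow> e'" for a b c e a' b' c' e'
        using that by (rule fract_continuous_image_closed[OF T(2) A.Hausdorff \<phi>_cont, unfolded T(1)])
    qed
    then show ?thesis using False by blast
  qed
  then obtain w where w: "w \<in> B" "w \<noteq> 0" "infinite B \<or> w = 1"
    and uni: "unipotents (level B w) \<subseteq> ?D" by blast
  obtain z where z: "z \<in> B" "1 + w\<^sup>2 * z \<notin> {0, 1, - 1}"
    using exists_nontrivial_torus_parameter[OF B w(1,2) _ two] w(3) B_not_F3 by blast
  obtain w' where w': "w' \<in> B" "w' \<noteq> 0" and E: "congruence_subgroup B ((*) (w'\<^sup>2) ` B) \<subseteq> ?E"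
    using commutators_contain_congruence_subgroup[OF B w(1,2) D_mult D_inv uni E_mult comm z] by blast
  have "ideal ((*) (w'\<^sup>2) ` B) (ring_of_type_algebra\<lparr>carrier := B\<rparr>)"
    using subring_setD(7)[OF B w'(1)] assms(12) by (intro principal_ideal_of_subring)
  moreover have "(*) (w'\<^sup>2) ` B \<noteq> {0}"
  proof -
    have "w'\<^sup>2 * 1 \<in> (*) (w'\<^sup>2) ` B" "w'\<^sup>2 * 1 \<noteq> 0"
      using w' subring_setD(1)[OF B] by (blast, simp)
    then show ?thesis by blast
  qed
  moreover have "congruence_subgroup B ((*) (w'\<^sup>2) ` B)
      \<subseteq> (\<lambda>g. matrix_inv y ** gma_embedding i j (\<rho>' g) ** y) ` carrier G"
    using E by (simp add: \<psi>_def conj_rep_def[abs_def])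
  ultimately show ?thesis
    unfolding full_def using rep' emb y by blast
qed

end
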